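(* Let $G=(V,E)$ be a planar graph, let $v\in V$ be a vertex (with $\deg v\ge 2$, so that $CC(v)$ is defined), and let $\beta_1(\operatorname{star}[v])=\dim H_1\big(F(G),F(G)\setminus \operatorname{star}[v]\big)$ be the local first Betti number at $[v]$ in the flag complex $F(G)$. Then $$\deg v-1-\frac{\deg v(\deg v-1)\,CC(v)}{2}\;\le\;\beta_1(\operatorname{star}[v])\;\le\;\deg v-1-\frac{\deg v(\deg v-1)\,CC(v)}{6}.$$
   Context: Graphs are undirected and simple, with countable vertex set and all vertex degrees finite. A graph is planar if it can be drawn in the plane so that edges meet only at common endpoints. $\deg v=|\{w\in V:(v,w)\in E\}|$. The open neighborhood $N(v)$ is the subgraph of $G$ induced by $\{w\in V:(v,w)\in E\}$ (so $v\notin N(v)$), and $E(N(v))$ is its edge set. The local clustering coefficient is $CC(v)=|E(N(v))|/\binom{\deg v}{2}$. An abstract simplicial complex $X$ with vertices in a countable set is a collection of nonempty finite subsets (simplices, or faces) closed under taking nonempty subsets; a simplex $\sigma$ has dimension $|\sigma|-1$. The flag complex $F(G)$ is the abstract simplicial complex whose simplices are the nonempty finite cliques of $G$ (vertex sets any two distinct elements of which are adjacent in $G$); $[v]$ is the $0$-simplex of $v$. Complexes are assumed locally finite: the star $\operatorname{star}\sigma=\{\tau\in X:\sigma\subseteq\tau\}$ of every simplex is a finite set. For a subcomplex $Y\subseteq X$, $C_k(X,Y)$ ($k\ge 0$) is the real vector space with basis the $k$-dimensional simplices of $X$ not in $Y$; with vertices listed in a fixed total order, the boundary map $\partial_k:C_k(X,Y)\to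 C_{k-1}(X,Y)$ is $\partial_k[v_0,\dots,v_k]=\sum_{i=0}^k(-1)^i[v_0,\dots,\widehat{v_i},\dots,v_k]$, with terms lying in $Y$ replaced by $0$ and $\partial_0=0$. $H_k(X,Y)$ is the homology of this chain complex, and "dim" is dimension over $\mathbb{R}$. *)

theory Defs
  imports
    "HOL-Analysis.Analysis"
    "HOL-Analysis.Finite_Function_Topology"
    "Jordan_Normal_Form.VS_Connect"
begin

section \<open>Graphs\<close>

text \<open>An undirected simple graph is a vertex set with a set of two-element edges.\<close>

definition neighbours :: "'a set set \<Rightarrow> 'a \<Rightarrow> 'a set" where
  "neighbours E v = {w. {v, w} \<in> E}"

definition deg :: "'a set set \<Rightarrow> 'a \<Rightarrow> nat" where
  "deg E v = card (neighbours E v)"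

definition induced_edges :: "'a set set \<Rightarrow> 'a set \<Rightarrow> 'a set set" where
  "induced_edges E W = {e \<in> E. e \<subseteq> W}"

definition clustering_coeff :: "'a set set \<Rightarrow> 'a \<Rightarrow> real" where
  "clustering_coeff E v =
    real (card (induced_edges E (neighbours E v))) / real (deg E v choose 2)"

locale locally_finite_graph =
  fixes V :: "'a set" and E :: "'a set set"
  assumes countable_vertices: "countable V"
    and edges: "e \<in> E \<Longrightarrow> e \<subseteq> V \<and> card e = 2"
    and finite_degree: "v \<in> V \<Longrightarrow> finite (neighbours E v)"

text \<open>
  A drawing places the vertices at distinct points of the plane and each edge on a simple arc
  joining its two end points. Arcs avoid all other vertices, and two arcs meet only in the images
  of common end points. For infinite graphs the vertices may accumulate.
\<close>

definition planar_drawing ::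
    "'a set \<Rightarrow> 'a set set \<Rightarrow> ('a \<Rightarrow> complex) \<Rightarrow> ('a set \<Rightarrow> real \<Rightarrow> complex) \<Rightarrow> bool" where
  "planar_drawing V E p \<gamma> \<longleftrightarrow>
    inj_on p V \<and>
    (\<forall>e\<in>E. arc (\<gamma> e) \<and> {pathstart (\<gamma> e), pathfinish (\<gamma> e)} = p ` e \<and>
       path_image (\<gamma> e) \<inter> p ` V = p ` e) \<and>
    (\<forall>e\<in>E. \<forall>f\<in>E. e \<noteq> f \<longrightarrow> path_image (\<gamma> e) \<inter> path_image (\<gamma> f) = p ` (e \<inter> f))"

definition planar_graph :: "'a set \<Rightarrow> 'a set set \<Rightarrow> bool" where
  "planar_graph V E \<longleftrightarrow> (\<exists>p \<gamma>. planar_drawing V E p \<gamma>)"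

section \<open>Simplicial complexes\<close>

definition flag_complex :: "'a set \<Rightarrow> 'a set set \<Rightarrow> 'a set set" where
  "flag_complex V E =
    {\<sigma>. \<sigma> \<noteq> {} \<and> finite \<sigma> \<and> \<sigma> \<subseteq> V \<and> (\<forall>u\<in>\<sigma>. \<forall>w\<in>\<sigma>. u \<noteq> w \<longrightarrow> {u, w} \<in> E)}"

definition star :: "'a set set \<Rightarrow> 'a set \<Rightarrow> 'a set set" where
  "star X \<sigma> = {\<tau> \<in> X. \<sigma> \<subseteq> \<tau>}"

section \<open>Relative simplicial homology with real coefficients\<close>

text \<open>
  Chains are finitely supported real functions on the set of simplices; the simplex \<open>\<sigma>\<close> is the
  basis vector \<open>Poly_Mapping.single \<sigma> 1\<close>.
\<close>

type_synonym 'a chain = "'a set \<Rightarrow>\<^sub>0 real"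

definition rel_chains :: "'a set set \<Rightarrow> 'a set set \<Rightarrow> nat \<Rightarrow> 'a chain set" where
  "rel_chains X Y k = {c. Poly_Mapping.keys c \<subseteq> {\<sigma> \<in> X - Y. card \<sigma> = k + 1}}"

text \<open>
  The vertices of \<open>\<sigma>\<close> are listed in increasing order, so \<open>u\<close> stands at position
  \<open>card {w \<in> \<sigma>. w < u}\<close>, counted from 0.
\<close>

definition simplex_boundary :: "'a::linorder set set \<Rightarrow> 'a set \<Rightarrow> 'a chain" where
  "simplex_boundary Y \<sigma> =
    (\<Sum>u | u \<in> \<sigma> \<and> \<sigma> - {u} \<notin> Y. Poly_Mapping.single (\<sigma> - {u}) ((-1) ^ card {w \<in> \<sigma>. w < u}))"

definition rel_boundary :: "'a::linorder set set \<Rightarrow> nat \<Rightarrow> 'a chain \<Rightarrow> 'a chain" where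
  "rel_boundary Y k c =
    (if k = 0 then 0
     else \<Sum>\<sigma>\<in>Poly_Mapping.keys c. Poly_Mapping.lookup c \<sigma> *\<^sub>R simplex_boundary Y \<sigma>)"

definition rel_cycles :: "'a::linorder set set \<Rightarrow> 'a set set \<Rightarrow> nat \<Rightarrow> 'a chain set" where
  "rel_cycles X Y k = {c \<in> rel_chains X Y k. rel_boundary Y k c = 0}"

definition rel_boundaries :: "'a::linorder set set \<Rightarrow> 'a set set \<Rightarrow> nat \<Rightarrow> 'a chain set" where
  "rel_boundaries X Y k = rel_boundary Y (k + 1) ` rel_chains X Y (k + 1)"

text \<open>
  The quotient of a linear subspace \<open>Z\<close> by a linear subspace \<open>B\<close>, with the cosets of \<open>B\<close> as
  elements. The summand \<open>b\<close> in the scalar multiplication only matters for the scalar 0, where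
  it makes the result \<open>B\<close> instead of \<open>{0}\<close>. A vector space is a record that also has the fields of
  a ring; its ring multiplication and unit play no role.
\<close>

definition quotient_vs :: "'v::real_vector set \<Rightarrow> 'v set \<Rightarrow> (real, 'v set) module" where
  "quotient_vs Z B =
    \<lparr>carrier = (\<lambda>z. {z + b | b. b \<in> B}) ` Z, mult = undefined, one = undefined,
     zero = B, add = (\<lambda>S T. {s + t | s t. s \<in> S \<and> t \<in> T}),
     smult = (\<lambda>r S. {r *\<^sub>R s + b | s b. s \<in> S \<and> b \<in> B})\<rparr>"

definition rel_homology ::
    "'a::linorder set set \<Rightarrow> 'a set set \<Rightarrow> nat \<Rightarrow> (real, 'a chain set) module" where
  "rel_homology X Y k = quotient_vs (rel_cycles X Y k) (rel_boundaries X Y k)"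

definition local_betti :: "'a::linorder set set \<Rightarrow> nat \<Rightarrow> 'a set \<Rightarrow> nat" where
  "local_betti X k \<sigma> = vectorspace.dim class_ring (rel_homology X (X - star X \<sigma>) k)"

lemma coset_add:
  assumes B: "Real_Vector_Spaces.subspace B"
  shows "{s + t | s t. s \<in> {x + b | b. b \<in> B} \<and> t \<in> {y + b | b. b \<in> B}} = {(x + y) + b | b. b \<in> B}"
    (is "?L = ?R")
proof
  show "?L \<subseteq> ?R"
  proof
    fix z assume "z \<in> ?L"
    then obtain b c where "b \<in> B" "c \<in> B" "z = (x + b) + (y + c)" by blast
    then have "z = (x + y) + (b + c)" "b + c \<in> B"
      using B by (auto simp: Real_Vector_Spaces.subspace_def)
    then show "z \<in> ?R" by blast
  qed
  show "?R \<subseteq> ?L"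
  proof
    fix z assume "z \<in> ?R"
    then obtain b where "b \<in> B" "z = (x + 0) + (y + b)" by (auto simp: add.assoc)
    moreover have "0 \<in> B" using B by (simp add: Real_Vector_Spaces.subspace_def)
    ultimately show "z \<in> ?L" by blast
  qed
qed

lemma coset_scale:
  assumes B: "Real_Vector_Spaces.subspace B"
  shows "{r *\<^sub>R s + b | s b. s \<in> {x + b | b. b \<in> B} \<and> b \<in> B} = {r *\<^sub>R x + b | b. b \<in> B}"
    (is "?L = ?R")
proof
  show "?L \<subseteq> ?R"
  proof
    fix z assume "z \<in> ?L"
    then obtain b c where "b \<in> B" "c \<in> B" "z = r *\<^sub>R (x + b) + c" by blast
    then have "z = r *\<^sub>R x + (r *\<^sub>R b + c)" "r *\<^sub>R b + c \<in> B"
      using B by (auto simp: Real_Vector_Spaces.subspace_def scaleR_add_right)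
    then show "z \<in> ?R" by blast
  qed
  show "?R \<subseteq> ?L"
  proof
    fix z assume "z \<in> ?R"
    then obtain b where "b \<in> B" "z = r *\<^sub>R (x + 0) + b" by auto
    moreover have "0 \<in> B" using B by (simp add: Real_Vector_Spaces.subspace_def)
    ultimately show "z \<in> ?L" by blast
  qed
qed

lemma vectorspace_quotient_vs:
  fixes Z B :: "'v::real_vector set"
  assumes Z: "Real_Vector_Spaces.subspace Z" and B: "Real_Vector_Spaces.subspace B"
  shows "vectorspace class_ring (quotient_vs Z B)"
proof -
  let ?Q = "quotient_vs Z B"
  define C where "C = (\<lambda>x. {x + b | b. b \<in> B})"
  have carr: "carrier ?Q = C ` Z" and zero: "\<zero>\<^bsub>?Q\<^esub> = C 0"
    by (simp_all add: quotient_vs_def C_def)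
  have add: "C x \<oplus>\<^bsub>?Q\<^esub> C y = C (x + y)" for x y
    using coset_add[OF B, of x y] by (simp add: quotient_vs_def C_def)
  have scale: "r \<odot>\<^bsub>?Q\<^esub> C x = C (r *\<^sub>R x)" for r x
    using coset_scale[OF B, of r x] by (simp add: quotient_vs_def C_def)
  have 0: "0 \<in> Z" and plus: "x \<in> Z \<Longrightarrow> y \<in> Z \<Longrightarrow> x + y \<in> Z" and sc: "x \<in> Z \<Longrightarrow> r *\<^sub>R x \<in> Z"
    for x y r
    using Z by (auto simp: Real_Vector_Spaces.subspace_def)
  have ab: "abelian_group ?Q"
  proof (rule abelian_groupI)
    show "\<exists>S\<in>carrier ?Q. S \<oplus>\<^bsub>?Q\<^esub> T = \<zero>\<^bsub>?Q\<^esub>" if T: "T \<in> carrier ?Q" for T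
    proof -
      obtain x where x: "x \<in> Z" "T = C x" using T by (auto simp: carr)
      have "C (-1 *\<^sub>R x) \<oplus>\<^bsub>?Q\<^esub> T = \<zero>\<^bsub>?Q\<^esub>" by (simp add: x add zero)
      then show ?thesis using sc[OF x(1), of "-1"] carr by blast
    qed
  qed (auto simp: carr zero add plus 0 ac_simps)
  have "Module.module (class_ring :: real ring) ?Q"
  proof (rule module.intro[OF class_cring.cring_axioms ab], unfold_locales)
  qed (clarsimp simp: carr add scale sc scaleR_add_left scaleR_add_right)+
  then show ?thesis
    using class_field by (simp add: vectorspace_def)
qed

lemma lookup_scaleR_chain: "Poly_Mapping.lookup (r *\<^sub>R c) \<sigma> = r * Poly_Mapping.lookup c \<sigma>" for c :: "'a chain"
  by (cases "r = 0")
     (auto simp: scaleR_poly_mapping_def in_keys_iff intro!: fun_cong[OF lookup_Abs_poly_mapping])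

lemma linear_rel_boundary: "linear (rel_boundary Y k)"
proof (cases "k = 0")
  case True
  then have "rel_boundary Y k = (\<lambda>_. 0)" by (auto simp: rel_boundary_def)
  then show ?thesis by (simp add: linear_iff)
next
  case False
  have sum_superset: "rel_boundary Y k c = (\<Sum>\<sigma>\<in>S. Poly_Mapping.lookup c \<sigma> *\<^sub>R simplex_boundary Y \<sigma>)"
    if "finite S" "Poly_Mapping.keys c \<subseteq> S" for c S
  proof -
    have "Poly_Mapping.lookup c \<sigma> *\<^sub>R simplex_boundary Y \<sigma> = 0" if "\<sigma> \<notin> Poly_Mapping.keys c" for \<sigma>
      using that by (simp add: in_keys_iff)
    with \<open>finite S\<close> \<open>Poly_Mapping.keys c \<subseteq> S\<close> show ?thesis
      unfolding rel_boundary_def using False by (simp, intro sum.mono_neutral_left) auto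
  qed
  have "rel_boundary Y k (c + d) = rel_boundary Y k c + rel_boundary Y k d" for c d
    using sum_superset[of "Poly_Mapping.keys c \<union> Poly_Mapping.keys d" c]
      sum_superset[of "Poly_Mapping.keys c \<union> Poly_Mapping.keys d" d]
      sum_superset[of "Poly_Mapping.keys c \<union> Poly_Mapping.keys d" "c + d"]
      Poly_Mapping.keys_add[of c d]
    by (simp add: lookup_add scaleR_add_left sum.distrib)
  moreover have "rel_boundary Y k (r *\<^sub>R c) = r *\<^sub>R rel_boundary Y k c" for r c
  proof -
    have "Poly_Mapping.keys (r *\<^sub>R c) \<subseteq> Poly_Mapping.keys c"
      by (auto simp: in_keys_iff lookup_scaleR_chain)
    then show ?thesis
      using sum_superset[of "Poly_Mapping.keys c" c] sum_superset[of "Poly_Mapping.keys c" "r *\<^sub>R c"]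
      by (simp add: scaleR_sum_right lookup_scaleR_chain)
  qed
  ultimately show ?thesis by (simp add: linear_iff)
qed

lemma subspace_rel_chains: "Real_Vector_Spaces.subspace (rel_chains X Y k)"
  unfolding Real_Vector_Spaces.subspace_def rel_chains_def
proof (intro conjI ballI allI CollectI; (drule CollectD)?; (drule CollectD)?)
  fix c d :: "'a chain" and r :: real
  let ?S = "{\<sigma> \<in> X - Y. card \<sigma> = k + 1}"
  show "Poly_Mapping.keys (0 :: 'a chain) \<subseteq> ?S" by simp
  assume c: "Poly_Mapping.keys c \<subseteq> ?S"
  have "Poly_Mapping.keys (r *\<^sub>R c) \<subseteq> Poly_Mapping.keys c" by (auto simp: in_keys_iff lookup_scaleR_chain)
  then show "Poly_Mapping.keys (r *\<^sub>R c) \<subseteq> ?S" using c by (rule order_trans)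
  assume "Poly_Mapping.keys d \<subseteq> ?S"
  then show "Poly_Mapping.keys (c + d) \<subseteq> ?S" using c Poly_Mapping.keys_add[of c d] by blast
qed

lemma subspace_rel_cycles: "Real_Vector_Spaces.subspace (rel_cycles X Y k)"
proof -
  have "rel_cycles X Y k = rel_chains X Y k \<inter> {c. rel_boundary Y k c = 0}"
    by (auto simp: rel_cycles_def)
  then show ?thesis
    by (simp add: Real_Vector_Spaces.subspace_inter subspace_rel_chains
        linear_subspace_kernel[OF linear_rel_boundary])
qed

lemma subspace_rel_boundaries: "Real_Vector_Spaces.subspace (rel_boundaries X Y k)"
  unfolding rel_boundaries_def
  by (rule linear_subspace_image[OF linear_rel_boundary subspace_rel_chains])

lemma vectorspace_rel_homology: "vectorspace class_ring (rel_homology X Y k)"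
  unfolding rel_homology_def
  by (rule vectorspace_quotient_vs[OF subspace_rel_cycles subspace_rel_boundaries])

end

theory Submission
  imports Defs
begin

text \<open>
  Relative to the complement of the star of \<open>v\<close>, a chain only sees the simplices through \<open>v\<close>, and
  removing \<open>v\<close> from such a simplex gives a simplex of the flag complex of \<open>N(v)\<close>, one dimension
  lower. So \<open>\<beta>\<^sub>1\<close> is the reduced zeroth Betti number of the graph \<open>N(v)\<close>:
  the relative 1-cycles are the combinations of the \<open>d = deg v\<close> edges at \<open>v\<close> whose suitably signed
  coefficients add up to zero, a space of dimension \<open>d - 1\<close>, and the boundary of a triangle
  \<open>{v, w, x}\<close> is, up to sign, the difference of two basis vectors \<open>e\<^sub>x - e\<^sub>w\<close>. Hence
  \<open>\<beta>\<^sub>1 = d - 1 - r\<close>, where \<open>r\<close> is the rank of these differences over all edges \<open>wx\<close> of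
  \<open>N(v)\<close> (lemma \<open>local_betti_1_eq\<close>). The number \<open>m\<close> of edges of \<open>N(v)\<close> is
  \<open>d (d - 1) CC(v) / 2\<close>, so the two bounds say \<open>r \<le> m\<close> and \<open>m \<le> 3 r\<close>.

  The first inequality is clear, since \<open>m\<close> vectors span a space of dimension at most \<open>m\<close>. For the second
  it suffices that \<open>N(v)\<close> is 3-degenerate, that is, that every nonempty set of neighbours of \<open>v\<close>
  contains a vertex with at most three neighbours in the set. Deleting such a vertex costs at most three
  edges, and lowers the rank by at least one if it was not isolated
  (lemma \<open>edges_le_degeneracy_times_rank\<close>).

  Planarity enters only through 3-degeneracy. A finite graph of minimum degree at least 4 contains two
  vertices joined by three internally disjoint paths that all have inner vertices
  (lemma \<open>theta_subgraph_if_min_degree_4\<close>, by a longest path argument). If such a theta graph lay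
  in \<open>N(v)\<close>, then \<open>v\<close> would be joined by edges to an inner vertex of each of the three paths, and the
  drawing would contain a subdivided \<open>K\<^sub>3\<^sub>,\<^sub>3\<close>. This is impossible
  (lemma \<open>no_point_sees_three_arcs_of_theta\<close>), by the Jordan curve theorem and Janiszewski's theorem.
\<close>

section \<open>Three arcs with common ends\<close>

text \<open>
  This is the nonplanarity of \<open>K\<^sub>3\<^sub>,\<^sub>3\<close>, with \<open>a\<close>, \<open>b\<close>, \<open>z\<close> on one side and the feet of the
  three legs on the other. The leg from \<open>z\<close> to an inner point of an arc avoids the closed curve formed by the
  other two arcs, so \<open>z\<close> lies on the same side of that curve as the open arc. Now let \<open>W\<close> be the
  side of the curve \<open>g1 \<union> g2\<close> that does not contain \<open>z\<close>. It misses \<open>g3\<close> as well and has inner points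
  of \<open>g1\<close> and of \<open>g2\<close> on its frontier; hence \<open>W\<close> is on the side of \<open>z\<close> with respect to both of the
  other curves. These two curves meet in the connected set \<open>g3\<close>, so by Janiszewski's theorem
  \<open>z\<close> is not separated from \<open>W\<close> by the whole theta graph, which contradicts the choice of \<open>W\<close>.
\<close>

lemma no_point_sees_three_arcs_of_theta:
  fixes g1 g2 g3 :: "real \<Rightarrow> complex" and z :: complex
  assumes arcs: "arc g1" "arc g2" "arc g3"
    and ends: "pathstart g1 = a" "pathfinish g1 = b" "pathstart g2 = a" "pathfinish g2 = b"
      "pathstart g3 = a" "pathfinish g3 = b"
    and meet: "path_image g1 \<inter> path_image g2 = {a, b}" "path_image g1 \<inter> path_image g3 = {a, b}"
      "path_image g2 \<inter> path_image g3 = {a, b}"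
    and legs: "connected L1" "connected L2" "connected L3" "z \<in> L1" "z \<in> L2" "z \<in> L3"
    and feet: "L1 \<inter> (path_image g1 - {a, b}) \<noteq> {}" "L2 \<inter> (path_image g2 - {a, b}) \<noteq> {}"
      "L3 \<inter> (path_image g3 - {a, b}) \<noteq> {}"
    and avoid: "L1 \<inter> (path_image g2 \<union> path_image g3) = {}"
      "L2 \<inter> (path_image g1 \<union> path_image g3) = {}"
      "L3 \<inter> (path_image g1 \<union> path_image g2) = {}"
  shows False
proof -
  define A1 A2 A3 where A: "A1 = path_image g1" "A2 = path_image g2" "A3 = path_image g3"
  have conn: "connected (A1 - {a, b})" "connected (A2 - {a, b})" "connected (A3 - {a, b})"
    using connected_simple_path_endless[of g1] connected_simple_path_endless[of g2]
      connected_simple_path_endless[of g3] arcs ends by (simp_all add: A arc_imp_simple_path)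
  have cpt: "compact A1" "compact A2" "compact A3" and cA3: "connected A3"
    using arcs by (simp_all add: A compact_arc_image connected_arc_image)
  have side: "connected_component (- (B \<union> C)) z x"
    if "connected (D - {a, b})" "connected L" "L \<inter> (D - {a, b}) \<noteq> {}" "z \<in> L"
      "L \<inter> (B \<union> C) = {}" "D \<inter> B = {a, b}" "D \<inter> C = {a, b}" "x \<in> D - {a, b}" for B C D L x
  proof -
    have "connected (L \<union> (D - {a, b}))" using that by (intro connected_Un) auto
    moreover have "L \<union> (D - {a, b}) \<subseteq> - (B \<union> C)" using that by auto
    ultimately show ?thesis using that by (meson UnCI connected_component_def)
  qed
  note feet' = feet[folded A] and avoid' = avoid[folded A] and meet' = meet[folded A]
  have meet'': "A2 \<inter> A1 = {a, b}" "A3 \<inter> A1 = {a, b}" "A3 \<inter> A2 = {a, b}"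
    using meet' by (simp_all add: Int_commute)
  note s3 = side[OF conn(3) legs(3) feet'(3) legs(6) avoid'(3) meet''(2,3)]
    and s2 = side[OF conn(2) legs(2) feet'(2) legs(5) avoid'(2) meet''(1) meet'(3)]
    and s1 = side[OF conn(1) legs(1) feet'(1) legs(4) avoid'(1) meet'(1,2)]
  let ?c = "g1 +++ reversepath g2"
  have c: "simple_path ?c" "pathfinish ?c = pathstart ?c" "path_image ?c = A1 \<union> A2"
    using arcs ends meet by (auto simp: A path_image_join intro!: simple_path_join_loop arc_reversepath)
  have "\<exists>W. open W \<and> connected W \<and> W \<noteq> {} \<and> frontier W = A1 \<union> A2 \<and> W \<subseteq> - (A1 \<union> A2) \<and>
      (\<forall>x\<in>W. \<not> connected_component (- (A1 \<union> A2)) z x)"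
  proof -
    let ?I = "inside (A1 \<union> A2)" and ?O = "outside (A1 \<union> A2)"
    have J: "?I \<noteq> {}" "open ?I" "connected ?I" "?O \<noteq> {}" "open ?O" "connected ?O"
      "?I \<inter> ?O = {}" "?I \<union> ?O = - (A1 \<union> A2)" "frontier ?I = A1 \<union> A2" "frontier ?O = A1 \<union> A2"
      using Jordan_inside_outside[OF c(1,2)] by (auto simp: c(3))
    have same: "x \<in> ?I \<longleftrightarrow> y \<in> ?I" if "connected_component (- (A1 \<union> A2)) x y" for x y
      using that inside_same_component[of "A1 \<union> A2" x y]
        inside_same_component[of "A1 \<union> A2" y x] connected_component_sym[OF that] by blast
    show ?thesis
    proof (cases "z \<in> ?I")
      case True
      with J same show ?thesis by (intro exI[of _ ?O]) blast
    next
      case False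
      with J same show ?thesis by (intro exI[of _ ?I]) blast
    qed
  qed
  then obtain W where W: "open W" "connected W" "W \<noteq> {}" "frontier W = A1 \<union> A2"
    "W \<subseteq> - (A1 \<union> A2)" "\<And>x. x \<in> W \<Longrightarrow> \<not> connected_component (- (A1 \<union> A2)) z x"
    by blast
  have "a \<in> A1" "b \<in> A1" using meet by (auto simp: A)
  then have W3: "W \<inter> A3 = {}" using W s3 by blast
  \<comment> \<open>since \<open>W\<close> is connected and misses the curve \<open>B \<union> A3\<close>, one point of \<open>W\<close> near the arc \<open>D\<close> decides its side\<close>
  have near: "connected_component (- (B \<union> A3)) z w"
    if s: "\<And>x. x \<in> D - {a, b} \<Longrightarrow> connected_component (- (B \<union> A3)) z x"
      and ne: "D - {a, b} \<noteq> {}" and sub: "D \<subseteq> frontier W" "B \<subseteq> A1 \<union> A2"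
      and cl: "closed (B \<union> A3)" and w: "w \<in> W" for B D w
  proof -
    obtain x where x: "x \<in> D - {a, b}" using ne by auto
    let ?K = "connected_component_set (- (B \<union> A3)) z"
    have "open ?K" using cl by (intro open_connected_component open_Compl)
    moreover have "x \<in> ?K" using s x by auto
    moreover have "x \<in> closure W" using x sub by (auto simp: frontier_def)
    ultimately obtain y where y: "y \<in> W" "connected_component (- (B \<union> A3)) z y"
      by (metis disjoint_iff mem_Collect_eq open_Int_closure_eq_empty)
    have "W \<subseteq> - (B \<union> A3)" using W(5) W3 sub by blast
    with W(2) y(1) w have "connected_component (- (B \<union> A3)) y w"
      by (meson connected_component_def)
    with y(2) show ?thesis by (rule connected_component_trans)
  qed
  obtain w where w: "w \<in> W" using W(3) by auto
  have "connected_component (- ((A1 \<union> A3) \<union> (A2 \<union> A3))) z w"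
  proof (rule Janiszewski)
    have "(A1 \<union> A3) \<inter> (A2 \<union> A3) = A3" using meet by (auto simp: A)
    then show "connected ((A1 \<union> A3) \<inter> (A2 \<union> A3))" using cA3 by simp
    show "connected_component (- (A1 \<union> A3)) z w"
      by (rule near[OF s2]) (use feet W w cpt in \<open>auto simp: A compact_imp_closed closed_Un\<close>)
    show "connected_component (- (A2 \<union> A3)) z w"
      by (rule near[OF s1]) (use feet W w cpt in \<open>auto simp: A compact_imp_closed closed_Un\<close>)
  qed (use cpt in \<open>simp_all add: compact_Un closed_Un compact_imp_closed\<close>)
  then have "connected_component (- (A1 \<union> A2)) z w"
    by (rule connected_component_of_subset) auto
  with W(6)[OF w] show False by contradiction
qed

section \<open>Theta subgraphs of graphs of minimum degree four\<close>

definition graph_path :: "'a set set \<Rightarrow> 'a list \<Rightarrow> bool" where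
  "graph_path E xs \<longleftrightarrow> distinct xs \<and> successively (\<lambda>x y. {x, y} \<in> E) xs"

text \<open>
  Among the longest paths \<open>u\<^sub>0, u\<^sub>1, \<dots>\<close>, choose one whose first vertex has its last neighbour
  \<open>u\<^sub>l\<close> as early as possible. Maximality puts all the neighbours of \<open>u\<^sub>0\<close> on the path. As there are at least four
  of them, one is some \<open>u\<^sub>i\<close> with \<open>3 \<le> i < l\<close>. Reversing the segment before \<open>u\<^sub>i\<close> gives another
  longest path, starting at \<open>u\<^sub>i\<^sub>-\<^sub>1\<close>, and the choice of the first path yields a neighbour
  \<open>u\<^sub>j\<close> of this vertex with \<open>j \<ge> l\<close>. The three paths from \<open>u\<^sub>0\<close> to it are the segment before
  \<open>u\<^sub>i\<close>, the path through \<open>u\<^sub>i\<close> alone, and the path that runs through \<open>u\<^sub>l, \<dots>, u\<^sub>j\<close>.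
\<close>

lemma theta_subgraph_if_min_degree_4:
  assumes fin: "finite U" and ne: "U \<noteq> {}"
    and deg: "\<And>u. u \<in> U \<Longrightarrow> 4 \<le> card (neighbours E u \<inter> U)"
    and irr: "\<And>u. {u} \<notin> E"
  obtains a b ps qs rs where
    "graph_path E (a # ps @ [b])" "graph_path E (a # qs @ [b])" "graph_path E (a # rs @ [b])"
    "ps \<noteq> []" "qs \<noteq> []" "rs \<noteq> []"
    "set ps \<inter> set qs = {}" "set ps \<inter> set rs = {}" "set qs \<inter> set rs = {}"
    "{a, b} \<union> set ps \<union> set qs \<union> set rs \<subseteq> U"
proof -
  \<comment> \<open>\<open>S\<close> collects the longest paths, \<open>J xs\<close> the positions on \<open>xs\<close> of the neighbours of its first vertex\<close>
  define P where "P = {xs. graph_path E xs \<and> set xs \<subseteq> U}"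
  define N where "N = Max (length ` P)"
  define S where "S = {xs \<in> P. length xs = N}"
  define J where "J xs = {j. j < length xs \<and> {hd xs, xs ! j} \<in> E}" for xs
  have finP: "finite P"
    by (rule finite_subset[OF _ finite_subset_distinct[OF fin]]) (auto simp: P_def graph_path_def)
  obtain u where "u \<in> U" using ne by auto
  then have uP: "[u] \<in> P" by (simp add: P_def graph_path_def)
  then have "N \<in> length ` P" unfolding N_def using finP by (intro Max_in) auto
  then have "S \<noteq> {}" by (auto simp: S_def)
  then obtain xs where xs: "xs \<in> S" and least: "\<And>ys. ys \<in> S \<Longrightarrow> Max (J xs) \<le> Max (J ys)"
    using ex_has_least_nat[of "\<lambda>xs. xs \<in> S" _ "\<lambda>xs. Max (J xs)"] by blast
  have longest: "length ys \<le> N" if "ys \<in> P" for ys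
    unfolding N_def using finP that by simp
  have "1 \<le> N" using longest[OF uP] by simp
  have cardJ: "4 \<le> card (J ys)" and finJ: "finite (J ys)" if ys: "ys \<in> S" for ys
  proof -
    show "finite (J ys)" by (simp add: J_def)
    have "ys \<noteq> []" using ys \<open>1 \<le> N\<close> by (auto simp: S_def)
    have path: "graph_path E ys" "set ys \<subseteq> U" "length ys = N" using ys by (auto simp: S_def P_def)
    \<comment> \<open>a neighbour of the first vertex outside the path would extend it\<close>
    have "neighbours E (hd ys) \<inter> U \<subseteq> set ys"
    proof (rule ccontr)
      assume "\<not> ?thesis"
      then obtain y where "{hd ys, y} \<in> E" "y \<in> U" "y \<notin> set ys" by (auto simp: neighbours_def)
      then have "y # ys \<in> P"
        using path \<open>ys \<noteq> []\<close> by (auto simp: P_def graph_path_def successively_Cons insert_commute)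
      from longest[OF this] path show False by simp
    qed
    have "neighbours E (hd ys) \<inter> U \<subseteq> (!) ys ` J ys"
    proof
      fix y assume y: "y \<in> neighbours E (hd ys) \<inter> U"
      then have "y \<in> set ys" using \<open>neighbours E (hd ys) \<inter> U \<subseteq> set ys\<close> by blast
      then obtain k where "k < length ys" "ys ! k = y" by (auto simp: in_set_conv_nth)
      with y show "y \<in> (!) ys ` J ys" by (auto simp: J_def neighbours_def)
    qed
    then have "card (neighbours E (hd ys) \<inter> U) \<le> card (J ys)"
      using \<open>finite (J ys)\<close> by (meson card_image_le card_mono finite_imageI le_trans)
    moreover have "hd ys \<in> U" using path \<open>ys \<noteq> []\<close> by auto
    ultimately show "4 \<le> card (J ys)" using deg[of "hd ys"] by linarith
  qed
  have path: "distinct xs" "successively (\<lambda>x y. {x, y} \<in> E) xs" "set xs \<subseteq> U" "length xs = N"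
    using xs by (auto simp: S_def P_def graph_path_def)
  have "xs \<noteq> []" using path \<open>1 \<le> N\<close> by auto
  define l where "l = Max (J xs)"
  have J0: "0 \<notin> J xs" using irr \<open>xs \<noteq> []\<close> by (auto simp: J_def hd_conv_nth)
  \<comment> \<open>a neighbour at position \<open>i \<ge> 3\<close> leaves room for an inner vertex on the segment before it\<close>
  have "card (J xs) - card {1, 2, l} \<le> card (J xs - {1, 2, l})" by (rule diff_card_le_card_Diff) simp
  moreover have "card {1, 2, l} \<le> 3" by (simp add: card_insert_if)
  ultimately have "card (J xs - {1, 2, l}) \<noteq> 0" using cardJ[OF xs] by linarith
  then have "J xs - {1, 2, l} \<noteq> {}" by (metis card.empty)
  then obtain i where i: "i \<in> J xs" "i \<noteq> 1" "i \<noteq> 2" "i \<noteq> l" by auto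
  have "i \<le> l" using i finJ[OF xs] by (simp add: l_def)
  moreover have "i \<noteq> 0" using i(1) J0 by metis
  ultimately have il: "3 \<le> i" "i < l" using i(2-4) by linarith+
  have "l \<in> J xs" using i finJ[OF xs] unfolding l_def by (intro Max_in) auto
  then have l: "l < length xs" "{hd xs, xs ! l} \<in> E" by (auto simp: J_def)
  have iE: "{hd xs, xs ! i} \<in> E" using i by (auto simp: J_def)
  \<comment> \<open>reversing the segment before \<open>i\<close> moves no vertex at position \<open>i\<close> or later\<close>
  define ys where "ys = rev (take i xs) @ drop i xs"
  have ne_take: "take i xs \<noteq> []" "drop i xs \<noteq> []" using il l by auto
  have hd_drop: "hd (drop i xs) = xs ! i" using il l by (simp add: hd_drop_conv_nth)
  have sp: "successively (\<lambda>x y. {x, y} \<in> E) (take i xs)" "successively (\<lambda>x y. {x, y} \<in> E) (drop i xs)"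
    "{last (take i xs), xs ! i} \<in> E"
  proof -
    have "successively (\<lambda>x y. {x, y} \<in> E) (take i xs @ drop i xs)" using path(2) by simp
    then show "successively (\<lambda>x y. {x, y} \<in> E) (take i xs)" "successively (\<lambda>x y. {x, y} \<in> E) (drop i xs)"
      "{last (take i xs), xs ! i} \<in> E"
      using ne_take hd_drop unfolding successively_append_iff by auto
  qed
  have di: "set (take i xs) \<inter> set (drop i xs) = {}" using path(1) by (simp add: set_take_disj_set_drop_if_distinct)
  have "ys \<in> S"
  proof -
    have "distinct ys" using di path(1) by (simp add: ys_def)
    moreover have "set ys = set xs"
      unfolding ys_def by (metis append_take_drop_id set_append set_rev)
    moreover have "length ys = N" using path(4) il l by (simp add: ys_def)
    moreover have "successively (\<lambda>x y. {x, y} \<in> E) ys"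
      using sp ne_take iE hd_drop \<open>xs \<noteq> []\<close> il
      by (simp add: ys_def successively_append_iff last_rev insert_commute)
    ultimately show ?thesis using path by (simp add: S_def P_def graph_path_def)
  qed
  define j where "j = Max (J ys)"
  have "j \<in> J ys" unfolding j_def using cardJ[OF \<open>ys \<in> S\<close>] finJ[OF \<open>ys \<in> S\<close>] by (intro Max_in) auto
  moreover have lj: "l \<le> j" unfolding l_def j_def by (rule least[OF \<open>ys \<in> S\<close>])
  moreover have "ys ! j = xs ! j" if "j < length xs"
    using il lj l that by (simp add: ys_def nth_append)
  moreover have "hd ys = last (take i xs)" using ne_take by (simp add: ys_def hd_rev)
  moreover have "length ys = length xs" by (simp add: ys_def)
  ultimately have j: "j < length xs" "{last (take i xs), xs ! j} \<in> E" by (auto simp: J_def)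
  obtain a b ps where T: "take i xs = a # ps @ [b]" and "ps \<noteq> []"
  proof -
    have "length (take i xs) \<ge> 3" using il l by simp
    then obtain a ts where 1: "take i xs = a # ts" "length ts \<ge> 2" by (cases "take i xs") auto
    then have "ts = butlast ts @ [last ts]" by (intro append_butlast_last_id[symmetric]) auto
    moreover have "length (butlast ts) \<noteq> 0" using 1 by simp
    then have "butlast ts \<noteq> []" by (metis list.size(3))
    ultimately have "take i xs = a # butlast ts @ [last ts]" "butlast ts \<noteq> []" using 1 by simp_all
    then show ?thesis by (rule that)
  qed
  \<comment> \<open>the segment from position \<open>l\<close> to position \<open>j\<close>, the interior of the third path\<close>
  define B where "B = take (Suc j - l) (drop l xs)"
  have B: "B \<noteq> []" "hd B = xs ! l" "last B = xs ! j"
    using l j lj by (simp_all add: B_def hd_drop_conv_nth last_conv_nth)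
  have D: "drop i xs = xs ! i # take (l - Suc i) (drop (Suc i) xs) @ B @ drop (Suc j) xs"
  proof -
    have "drop l xs = B @ drop (Suc j) xs"
      using lj by (metis B_def append_take_drop_id drop_drop le_SucI ordered_cancel_comm_monoid_diff_class.diff_add)
    moreover have "drop (Suc i) xs = take (l - Suc i) (drop (Suc i) xs) @ drop l xs"
      using il by (metis Suc_leI append_take_drop_id drop_drop ordered_cancel_comm_monoid_diff_class.diff_add)
    ultimately show ?thesis using il l by (metis Cons_nth_drop_Suc order.strict_trans)
  qed
  have a: "hd xs = a" using T \<open>xs \<noteq> []\<close> il by (metis hd_take list.sel(1) gr0I not_numeral_le_zero)
  have spB: "successively (\<lambda>x y. {x, y} \<in> E) B"
    using sp(2) unfolding D by (auto simp: successively_Cons successively_append_iff)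
  have dist: "distinct ((a # ps @ [b]) @ xs ! i # take (l - Suc i) (drop (Suc i) xs) @ B @ drop (Suc j) xs)"
    using path(1) by (metis T D append_take_drop_id)
  have sub: "set ((a # ps @ [b]) @ xs ! i # take (l - Suc i) (drop (Suc i) xs) @ B @ drop (Suc j) xs) \<subseteq> U"
    using path(3) by (metis T D append_take_drop_id)
  show thesis
  proof (rule that)
    show "graph_path E (a # ps @ [b])" using sp(1) dist by (auto simp: graph_path_def T)
    show "graph_path E (a # [xs ! i] @ [b])"
      using sp(3) iE dist by (auto simp: graph_path_def T a insert_commute)
    show "graph_path E (a # B @ [b])"
      using spB B l(2) j(2) dist
      by (auto simp: graph_path_def T a insert_commute successively_Cons successively_append_iff)
    show "{a, b} \<union> set ps \<union> set [xs ! i] \<union> set B \<subseteq> U" using sub by auto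
  qed (use \<open>ps \<noteq> []\<close> B dist in auto)
qed

section \<open>Neighbourhoods in planar graphs\<close>

fun walk_edges :: "'a list \<Rightarrow> 'a set set" where
  "walk_edges (x # y # xs) = insert {x, y} (walk_edges (y # xs))"
| "walk_edges _ = {}"

lemma walk_edges_subset_vertices: "e \<in> walk_edges xs \<Longrightarrow> e \<subseteq> set xs"
  by (induction xs rule: walk_edges.induct) auto

lemma walk_edges_subset_edges: "graph_path E xs \<Longrightarrow> walk_edges xs \<subseteq> E"
  by (induction xs rule: walk_edges.induct) (auto simp: graph_path_def)

lemma walk_edges_cover: "2 \<le> length xs \<Longrightarrow> x \<in> set xs \<Longrightarrow> \<exists>e\<in>walk_edges xs. x \<in> e"
proof (induction xs rule: walk_edges.induct)
  case (1 y z zs)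
  then show ?case by (cases zs) auto
qed auto

text \<open>
  The two ends of a path with an inner vertex are not consecutive on it. So two such paths that
  share only their ends have no edge in common.
\<close>

lemma walk_edge_meets_interior:
  "e \<in> walk_edges (a # ps @ [b]) \<Longrightarrow> ps \<noteq> [] \<Longrightarrow> e \<inter> set ps \<noteq> {}"
proof (induction ps arbitrary: a)
  case (Cons c ps)
  then show ?case by (cases "ps = []") auto
qed simp

text \<open>
  The arc that a drawing assigns to an edge may run in either direction.
\<close>

lemma arc_along_edge:
  assumes "planar_drawing V E p \<gamma>" "{x, y} \<in> E"
  obtains h where "arc h" "pathstart h = p x" "pathfinish h = p y"
    "path_image h = path_image (\<gamma> {x, y})"
proof -
  have h: "arc (\<gamma> {x, y})" "{pathstart (\<gamma> {x, y}), pathfinish (\<gamma> {x, y})} = {p x, p y}"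
    using assms by (auto simp: planar_drawing_def)
  then consider "pathstart (\<gamma> {x, y}) = p x" "pathfinish (\<gamma> {x, y}) = p y"
    | "pathstart (\<gamma> {x, y}) = p y" "pathfinish (\<gamma> {x, y}) = p x"
    by (auto simp: doubleton_eq_iff)
  then show thesis
  proof cases
    case 1
    then show thesis using that h by blast
  next
    case 2
    then show thesis using that[of "reversepath (\<gamma> {x, y})"] h by (simp add: arc_reversepath)
  qed
qed

lemma arc_along_graph_path:
  assumes D: "planar_drawing V E p \<gamma>"
  shows "graph_path E xs \<Longrightarrow> 2 \<le> length xs \<Longrightarrow>
    \<exists>g. arc g \<and> pathstart g = p (hd xs) \<and> pathfinish g = p (last xs) \<and>
      path_image g = (\<Union>e\<in>walk_edges xs. path_image (\<gamma> e))"
proof (induction xs rule: walk_edges.induct)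
  case (1 x y zs)
  have xy: "{x, y} \<in> E" and path: "graph_path E (y # zs)" and x: "x \<notin> set (y # zs)"
    using 1 by (auto simp: graph_path_def)
  obtain h where h: "arc h" "pathstart h = p x" "pathfinish h = p y"
    "path_image h = path_image (\<gamma> {x, y})" using arc_along_edge[OF D xy] .
  show ?case
  proof (cases zs)
    case Nil
    then show ?thesis using h by auto
  next
    case (Cons z zs')
    then have "2 \<le> length (y # zs)" by simp
    from 1(1)[OF path this] obtain g where g: "arc g" "pathstart g = p y"
      "pathfinish g = p (last (y # zs))" "path_image g = (\<Union>e\<in>walk_edges (y # zs). path_image (\<gamma> e))"
      by auto
    have "path_image (\<gamma> {x, y}) \<inter> path_image (\<gamma> e) \<subseteq> {p y}" if e: "e \<in> walk_edges (y # zs)" for e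
    proof -
      have "x \<notin> e" using walk_edges_subset_vertices[OF e] x by auto
      moreover from this have "path_image (\<gamma> {x, y}) \<inter> path_image (\<gamma> e) = p ` ({x, y} \<inter> e)"
        using D xy walk_edges_subset_edges[OF path] e unfolding planar_drawing_def
        by (metis insertI1 subsetD)
      ultimately show ?thesis by auto
    qed
    then have "path_image h \<inter> path_image g \<subseteq> {pathstart g}" using h g by auto
    then have "arc (h +++ g)" using h g by (intro arc_join) auto
    then show ?thesis using h g by (intro exI[of _ "h +++ g"]) (auto simp: path_image_join)
  qed
qed auto

text \<open>
  If every vertex of \<open>U\<close> had four neighbours in \<open>U\<close>, the subgraph on \<open>U\<close> would contain a theta graph with an
  inner vertex on each of its three paths. The arcs drawn from \<open>v\<close> to these inner vertices would be
  legs to the three arcs of a theta curve, in the position excluded by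
  \<open>no_point_sees_three_arcs_of_theta\<close>.
\<close>

lemma neighbourhood_has_vertex_of_degree_le_3:
  assumes G: "locally_finite_graph V E" and D: "planar_drawing V E p \<gamma>"
    and fin: "finite U" and ne: "U \<noteq> {}" and U: "U \<subseteq> neighbours E v"
  shows "\<exists>u\<in>U. card (neighbours E u \<inter> U) \<le> 3"
proof (rule ccontr)
  assume "\<not> ?thesis"
  then have big: "4 \<le> card (neighbours E u \<inter> U)" if "u \<in> U" for u
    using that by (simp add: not_le) (metis Suc_leI eval_nat_numeral(2) numeral_3_eq_3 semiring_norm(26,27))
  have E: "e \<subseteq> V" "card e = 2" if "e \<in> E" for e
    using locally_finite_graph.edges[OF G that] by auto
  have irr: "{u} \<notin> E" for u using E(2)[of "{u}"] by auto
  obtain a b ps qs rs where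
    paths: "graph_path E (a # ps @ [b])" "graph_path E (a # qs @ [b])" "graph_path E (a # rs @ [b])"
    and ne: "ps \<noteq> []" "qs \<noteq> []" "rs \<noteq> []"
    and disj: "set ps \<inter> set qs = {}" "set ps \<inter> set rs = {}" "set qs \<inter> set rs = {}"
    and sub: "{a, b} \<union> set ps \<union> set qs \<union> set rs \<subseteq> U"
    by (rule theta_subgraph_if_min_degree_4[OF fin ne big irr])
  have vU: "v \<notin> U" using U irr[of v] by (auto simp: neighbours_def)
  have UV: "U \<subseteq> V" using U E(1) by (auto simp: neighbours_def)
  have inj: "inj_on p V" and ends: "p ` e \<subseteq> path_image (\<gamma> e)" if "e \<in> E" for e
    using D that unfolding planar_drawing_def by blast+
  have cross: "path_image (\<gamma> e) \<inter> path_image (\<gamma> f) = p ` (e \<inter> f)" if "e \<in> E" "f \<in> E" "e \<noteq> f" for e f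
    using D that unfolding planar_drawing_def by blast
  have arcs: "\<exists>g. arc g \<and> pathstart g = p a \<and> pathfinish g = p b \<and>
      path_image g = (\<Union>e\<in>walk_edges (a # xs @ [b]). path_image (\<gamma> e))"
    if "graph_path E (a # xs @ [b])" for xs
    using arc_along_graph_path[OF D that] by simp
  obtain g1 g2 g3 where
    g1: "arc g1" "pathstart g1 = p a" "pathfinish g1 = p b"
      "path_image g1 = (\<Union>e\<in>walk_edges (a # ps @ [b]). path_image (\<gamma> e))" and
    g2: "arc g2" "pathstart g2 = p a" "pathfinish g2 = p b"
      "path_image g2 = (\<Union>e\<in>walk_edges (a # qs @ [b]). path_image (\<gamma> e))" and
    g3: "arc g3" "pathstart g3 = p a" "pathfinish g3 = p b"
      "path_image g3 = (\<Union>e\<in>walk_edges (a # rs @ [b]). path_image (\<gamma> e))"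
    using arcs[OF paths(1)] arcs[OF paths(2)] arcs[OF paths(3)] by blast
  have meet: "path_image g \<inter> path_image h = {p a, p b}"
    if g: "pathstart g = p a" "pathfinish g = p b"
      "path_image g = (\<Union>e\<in>walk_edges (a # xs @ [b]). path_image (\<gamma> e))"
    and h: "pathstart h = p a" "pathfinish h = p b"
      "path_image h = (\<Union>e\<in>walk_edges (a # ys @ [b]). path_image (\<gamma> e))"
    and path: "graph_path E (a # xs @ [b])" "graph_path E (a # ys @ [b])"
    and "xs \<noteq> []" "set xs \<inter> set ys = {}" for g h xs ys
  proof
    show "{p a, p b} \<subseteq> path_image g \<inter> path_image h"
      using pathstart_in_path_image[of g] pathfinish_in_path_image[of g]
        pathstart_in_path_image[of h] pathfinish_in_path_image[of h] g h by simp
    have "path_image (\<gamma> e) \<inter> path_image (\<gamma> f) \<subseteq> {p a, p b}"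
      if e: "e \<in> walk_edges (a # xs @ [b])" and f: "f \<in> walk_edges (a # ys @ [b])" for e f
    proof -
      have ef: "e \<subseteq> set (a # xs @ [b])" "f \<subseteq> set (a # ys @ [b])"
        using walk_edges_subset_vertices e f by blast+
      have "e \<inter> set xs \<noteq> {}" by (rule walk_edge_meets_interior[OF e \<open>xs \<noteq> []\<close>])
      then have "e \<noteq> f" using ef path(1) \<open>set xs \<inter> set ys = {}\<close> by (auto simp: graph_path_def)
      then have "path_image (\<gamma> e) \<inter> path_image (\<gamma> f) = p ` (e \<inter> f)"
        using cross walk_edges_subset_edges path e f by blast
      also have "e \<inter> f \<subseteq> {a, b}" using ef \<open>set xs \<inter> set ys = {}\<close> by auto
      finally show ?thesis by auto
    qed
    then show "path_image g \<inter> path_image h \<subseteq> {p a, p b}" unfolding g h by blast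
  qed
  have spoke: "{v, x} \<in> E" if "x \<in> U" for x using that U by (auto simp: neighbours_def)
  have foot: "path_image (\<gamma> {v, x}) \<inter> (path_image g - {p a, p b}) \<noteq> {}"
    if g: "path_image g = (\<Union>e\<in>walk_edges (a # xs @ [b]). path_image (\<gamma> e))"
      and path: "graph_path E (a # xs @ [b])" and x: "x \<in> set xs" and xs: "set xs \<subseteq> U" for g xs x
  proof -
    obtain e where "e \<in> walk_edges (a # xs @ [b])" "x \<in> e"
      using walk_edges_cover[of "a # xs @ [b]" x] x by auto
    then have "p x \<in> path_image g" using g walk_edges_subset_edges[OF path] ends by blast
    moreover have "x \<noteq> a" "x \<noteq> b" using path x by (auto simp: graph_path_def)
    then have "p x \<noteq> p a" "p x \<noteq> p b"
      using inj[OF spoke] UV x xs sub by (auto dest!: inj_onD)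
    moreover have "p x \<in> path_image (\<gamma> {v, x})" using ends[OF spoke] x xs by auto
    ultimately show ?thesis by blast
  qed
  have avoid: "path_image (\<gamma> {v, x}) \<inter> path_image g = {}"
    if g: "path_image g = (\<Union>e\<in>walk_edges (a # xs @ [b]). path_image (\<gamma> e))"
      and path: "graph_path E (a # xs @ [b])" and xs: "set xs \<subseteq> U"
      and x: "x \<in> U" "x \<notin> set (a # xs @ [b])" for g xs x
  proof -
    have "path_image (\<gamma> {v, x}) \<inter> path_image (\<gamma> e) = {}" if e: "e \<in> walk_edges (a # xs @ [b])" for e
    proof -
      have "{v, x} \<inter> e = {}"
        using walk_edges_subset_vertices[OF e] x xs sub vU by auto
      then show ?thesis
        using cross[OF spoke[OF x(1)], of e] walk_edges_subset_edges[OF path] e by auto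
    qed
    then show ?thesis unfolding g by blast
  qed
  obtain x1 x2 x3 where x: "x1 \<in> set ps" "x2 \<in> set qs" "x3 \<in> set rs"
    using ne by (meson list.set_sel(1))
  have d: "x1 \<noteq> a" "x1 \<noteq> b" "x2 \<noteq> a" "x2 \<noteq> b" "x3 \<noteq> a" "x3 \<noteq> b"
    using paths x by (auto simp: graph_path_def)
  have xU: "x1 \<in> U" "x2 \<in> U" "x3 \<in> U" and setsU: "set ps \<subseteq> U" "set qs \<subseteq> U" "set rs \<subseteq> U"
    using x sub by auto
  have sep: "x1 \<notin> set (a # qs @ [b])" "x1 \<notin> set (a # rs @ [b])"
    "x2 \<notin> set (a # ps @ [b])" "x2 \<notin> set (a # rs @ [b])"
    "x3 \<notin> set (a # ps @ [b])" "x3 \<notin> set (a # qs @ [b])"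
    using d x disj by auto
  have pv: "p v \<in> path_image (\<gamma> {v, x})" if "x \<in> U" for x using ends[OF spoke[OF that]] by auto
  have con: "connected (path_image (\<gamma> {v, x}))" if "x \<in> U" for x
    using D spoke[OF that] by (auto simp: planar_drawing_def connected_arc_image)
  show False
  proof (rule no_point_sees_three_arcs_of_theta[of g1 g2 g3 "p a" "p b"
        "path_image (\<gamma> {v, x1})" "path_image (\<gamma> {v, x2})" "path_image (\<gamma> {v, x3})" "p v"])
    show "path_image g1 \<inter> path_image g2 = {p a, p b}"
      by (rule meet[OF g1(2-4) g2(2-4) paths(1,2) ne(1) disj(1)])
    show "path_image g1 \<inter> path_image g3 = {p a, p b}"
      by (rule meet[OF g1(2-4) g3(2-4) paths(1,3) ne(1) disj(2)])
    show "path_image g2 \<inter> path_image g3 = {p a, p b}"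
      by (rule meet[OF g2(2-4) g3(2-4) paths(2,3) ne(2) disj(3)])
    show "path_image (\<gamma> {v, x1}) \<inter> (path_image g2 \<union> path_image g3) = {}"
      using avoid[OF g2(4) paths(2) setsU(2) xU(1) sep(1)]
        avoid[OF g3(4) paths(3) setsU(3) xU(1) sep(2)] by blast
    show "path_image (\<gamma> {v, x2}) \<inter> (path_image g1 \<union> path_image g3) = {}"
      using avoid[OF g1(4) paths(1) setsU(1) xU(2) sep(3)]
        avoid[OF g3(4) paths(3) setsU(3) xU(2) sep(4)] by blast
    show "path_image (\<gamma> {v, x3}) \<inter> (path_image g1 \<union> path_image g2) = {}"
      using avoid[OF g1(4) paths(1) setsU(1) xU(3) sep(5)]
        avoid[OF g2(4) paths(2) setsU(2) xU(3) sep(6)] by blast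
  qed (fact g1 g2 g3 foot[OF g1(4) paths(1) x(1) setsU(1)] foot[OF g2(4) paths(2) x(2) setsU(2)]
      foot[OF g3(4) paths(3) x(3) setsU(3)] pv[OF xU(1)] pv[OF xU(2)] pv[OF xU(3)]
      con[OF xU(1)] con[OF xU(2)] con[OF xU(3)])+
qed

section \<open>Dimensions of quotients and kernels\<close>

lemma card_independent_le_dim:
  fixes B :: "'v::real_vector set"
  assumes "finite F" "B \<subseteq> span F" "S \<subseteq> B" "independent S"
  shows "card S \<le> dim B"
proof -
  obtain T where T: "T \<subseteq> B" "independent T" "B \<subseteq> span T" "card T = dim B"
    using real_vector.basis_exists by blast
  then have "finite T" using real_vector.independent_span_bound assms(1,2) by blast
  then show ?thesis using real_vector.independent_span_bound[of T S] assms(3,4) T by auto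
qed

text \<open>
  The cosets of the vectors that extend a basis \<open>S\<close> of \<open>B\<close> to a basis \<open>T\<close> of \<open>Z\<close> form a basis of the
  quotient.
\<close>

lemma dim_quotient_vs:
  fixes Z B :: "'v::real_vector set"
  assumes Z: "Real_Vector_Spaces.subspace Z" and B: "Real_Vector_Spaces.subspace B" and BZ: "B \<subseteq> Z"
    and F: "finite F" "Z \<subseteq> span F"
  shows "vectorspace.dim class_ring (quotient_vs Z B) + dim B = dim Z"
proof -
  obtain S where S: "S \<subseteq> B" "independent S" "B \<subseteq> span S" "card S = dim B"
    using real_vector.basis_exists by blast
  obtain T where T: "S \<subseteq> T" "T \<subseteq> Z" "independent T" "Z \<subseteq> span T"
    using real_vector.maximal_independent_subset_extend[of S Z] S BZ by blast
  have finT: "finite T" using real_vector.independent_span_bound[OF F(1) T(3)] T(2) F(2) by auto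
  then have finS: "finite S" using T(1) finite_subset by blast
  have cardT: "card T = dim Z" using real_vector.basis_card_eq_dim T by blast
  let ?Q = "quotient_vs Z B"
  define C where "C = (\<lambda>x. {x + b | b. b \<in> B})"
  interpret Q: vectorspace class_ring ?Q by (rule vectorspace_quotient_vs[OF Z B])
  have carr: "carrier ?Q = C ` Z" and zero: "\<zero>\<^bsub>?Q\<^esub> = C 0"
    by (simp_all add: quotient_vs_def C_def)
  have add: "C x \<oplus>\<^bsub>?Q\<^esub> C y = C (x + y)" for x y
    using coset_add[OF B, of x y] by (simp add: quotient_vs_def C_def)
  have scale: "r \<odot>\<^bsub>?Q\<^esub> C x = C (r *\<^sub>R x)" for r x
    using coset_scale[OF B, of r x] by (simp add: quotient_vs_def C_def)
  have C_eq: "C x = C y \<longleftrightarrow> x - y \<in> B" for x y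
  proof
    assume "C x = C y"
    moreover have "x \<in> C x" using B by (force simp: C_def real_vector.subspace_0)
    ultimately show "x - y \<in> B" by (auto simp: C_def)
  next
    assume d: "x - y \<in> B"
    have "C x \<subseteq> C y" if "x - y \<in> B" for x y
    proof
      fix z assume "z \<in> C x"
      then obtain b where b: "b \<in> B" "z = x + b" by (auto simp: C_def)
      then have "z = y + ((x - y) + b)" by simp
      moreover have "(x - y) + b \<in> B" using real_vector.subspace_add[OF B that b(1)] .
      ultimately show "z \<in> C y" unfolding C_def by blast
    qed
    moreover have "y - x \<in> B" using real_vector.subspace_neg[OF B d] by simp
    ultimately show "C x = C y" using d by blast
  qed
  define R where "R = T - S"
  have R: "finite R" "R \<subseteq> Z" using finT T(2) by (auto simp: R_def)
  \<comment> \<open>a combination of the vectors outside \<open>S\<close> that lies in \<open>B\<close> is trivial\<close>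
  have indep: "c x = 0" if sum: "(\<Sum>x\<in>R. c x *\<^sub>R x) \<in> B" and x: "x \<in> R" for c x
  proof -
    obtain d where d: "(\<Sum>x\<in>R. c x *\<^sub>R x) = (\<Sum>y\<in>S. d y *\<^sub>R y)"
      using subsetD[OF S(3) sum] unfolding real_vector.span_finite[OF finS] by (rule rangeE)
    define u where "u y = (if y \<in> S then - d y else c y)" for y
    have "(\<Sum>y\<in>T. u y *\<^sub>R y) = (\<Sum>y\<in>R. u y *\<^sub>R y) + (\<Sum>y\<in>S. u y *\<^sub>R y)"
      unfolding R_def using finT T(1) by (rule sum.subset_diff[rotated])
    also have "(\<Sum>y\<in>R. u y *\<^sub>R y) = (\<Sum>y\<in>R. c y *\<^sub>R y)"
      by (rule sum.cong) (auto simp: u_def R_def)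
    also have "(\<Sum>y\<in>S. u y *\<^sub>R y) = - (\<Sum>y\<in>S. d y *\<^sub>R y)"
      by (simp add: u_def sum_negf)
    finally have "(\<Sum>y\<in>T. u y *\<^sub>R y) = 0" using d by simp
    then have "u x = 0"
      using real_vector.independentD[OF T(3) finT order_refl] x by (auto simp: R_def)
    then show ?thesis using x by (simp add: u_def R_def)
  qed
  have inj: "inj_on C R"
  proof (rule inj_onI, rule ccontr)
    fix x y assume xy: "x \<in> R" "y \<in> R" "C x = C y" "x \<noteq> y"
    define c where "c z = (if z = x then 1 else if z = y then - 1 else 0 :: real)" for z
    have "(\<Sum>z\<in>R. c z *\<^sub>R z) = (\<Sum>z\<in>{x, y}. c z *\<^sub>R z)"
      by (rule sum.mono_neutral_right) (use R xy in \<open>auto simp: c_def\<close>)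
    also have "\<dots> = x - y" using xy by (simp add: c_def)
    finally have "(\<Sum>z\<in>R. c z *\<^sub>R z) \<in> B" using xy C_eq by simp
    from indep[OF this xy(1)] show False by (simp add: c_def)
  qed
  have closed: "C x \<in> carrier ?Q" if "x \<in> Z" for x using that by (simp add: carr)
  have finsum: "finsum ?Q (\<lambda>x. C (f x)) A = C (sum f A)" if "finite A" "\<And>x. x \<in> A \<Longrightarrow> f x \<in> Z" for f A
    using that
  proof (induction A rule: finite_induct)
    case empty
    then show ?case by (simp add: zero)
  next
    case (insert x A)
    then have "finsum ?Q (\<lambda>x. C (f x)) (insert x A) = C (f x) \<oplus>\<^bsub>?Q\<^esub> finsum ?Q (\<lambda>x. C (f x)) A"
      by (intro Q.finsum_insert) (auto intro: closed)
    then show ?case using insert by (simp add: add)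
  qed
  have lincomb: "Q.lincomb a (C ` R) = C (\<Sum>x\<in>R. a (C x) *\<^sub>R x)" for a
  proof -
    have "a (C x) *\<^sub>R x \<in> Z" if "x \<in> R" for x
      using that R(2) Z real_vector.subspace_scale by blast
    moreover from this have "Q.lincomb a (C ` R) = (\<Oplus>\<^bsub>?Q\<^esub>x\<in>R. a (C x) \<odot>\<^bsub>?Q\<^esub> C x)"
      unfolding Q.lincomb_def by (intro Q.finsum_reindex inj) (auto simp: scale closed)
    ultimately show ?thesis using finsum[OF R(1)] by (simp add: scale)
  qed
  have "Q.basis (C ` R)"
    unfolding Q.basis_def
  proof (intro conjI)
    show sub: "C ` R \<subseteq> carrier ?Q" using R(2) closed by auto
    show "Q.lin_indpt (C ` R)"
    proof (rule Q.finite_lin_indpt2[OF finite_imageI[OF R(1)] sub])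
      fix a assume "Q.lincomb a (C ` R) = \<zero>\<^bsub>?Q\<^esub>"
      then have "(\<Sum>x\<in>R. a (C x) *\<^sub>R x) \<in> B" by (simp add: lincomb zero C_eq)
      from indep[OF this] show "\<forall>v\<in>C ` R. a v = \<zero>\<^bsub>class_ring\<^esub>" by (simp add: class_ring_simps)
    qed
    show "Q.gen_set (C ` R)"
    proof
      show "Q.span (C ` R) \<subseteq> carrier ?Q" by (rule Q.span_is_subset2[OF sub])
      show "carrier ?Q \<subseteq> Q.span (C ` R)"
      proof
        fix q assume "q \<in> carrier ?Q"
        then obtain z where z: "z \<in> Z" "q = C z" by (auto simp: carr)
        obtain c where c: "z = (\<Sum>x\<in>T. c x *\<^sub>R x)"
          using subsetD[OF T(4) z(1)] unfolding real_vector.span_finite[OF finT] by (rule rangeE)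
        define a where "a = (\<lambda>q. c (inv_into R C q))"
        have "z = (\<Sum>x\<in>R. c x *\<^sub>R x) + (\<Sum>x\<in>S. c x *\<^sub>R x)"
          unfolding c R_def using finT T(1) by (rule sum.subset_diff[rotated])
        moreover have "(\<Sum>x\<in>S. c x *\<^sub>R x) \<in> B"
          by (rule real_vector.subspace_sum[OF B]) (use S(1) B real_vector.subspace_scale in blast)
        ultimately have "q = C (\<Sum>x\<in>R. c x *\<^sub>R x)" using z(2) by (simp add: C_eq)
        also have "(\<Sum>x\<in>R. c x *\<^sub>R x) = (\<Sum>x\<in>R. a (C x) *\<^sub>R x)"
          using inj by (intro sum.cong) (auto simp: a_def)
        finally have "q = Q.lincomb a (C ` R)" by (simp add: lincomb)
        then show "q \<in> Q.span (C ` R)"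
          unfolding Q.span_def using R(1) by (auto simp: class_ring_simps)
      qed
    qed
  qed
  then have "vectorspace.dim class_ring ?Q = card (C ` R)" using R(1) by (intro Q.dim_basis) auto
  also have "\<dots> = card T - card S" using card_image[OF inj] finS T(1) by (simp add: R_def card_Diff_subset)
  finally show ?thesis using S(4) cardT card_mono[OF finT T(1)] by simp
qed

text \<open>
  On a combination of \<open>T\<close> the map takes the value (sum of the coefficients) \<open>* y\<close>. So the kernel is spanned by
  the differences \<open>t - t0\<close> with a fixed basis vector \<open>t0\<close>, and adding \<open>t0\<close> to a basis of the kernel
  generates all of \<open>T\<close>. It is used for the map that sends every edge at \<open>v\<close>, with the right sign, to
  the vertex \<open>v\<close>.
\<close>

lemma dim_kernel_of_constant_on_basis:
  fixes f :: "'v::real_vector \<Rightarrow> 'w::real_vector"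
  assumes f: "linear f" and T: "finite T" "T \<noteq> {}" "independent T"
    and const: "\<And>t. t \<in> T \<Longrightarrow> f t = y" and "y \<noteq> 0"
  shows "dim {c \<in> span T. f c = 0} + 1 = card T"
proof -
  let ?K = "{c \<in> span T. f c = 0}"
  obtain t0 where t0: "t0 \<in> T" using T(2) by auto
  define D where "D = (\<lambda>t. t - t0) ` (T - {t0})"
  have "?K \<subseteq> span D"
  proof
    fix c assume c: "c \<in> ?K"
    then obtain u where u: "c = (\<Sum>t\<in>T. u t *\<^sub>R t)"
      using real_vector.span_finite[OF T(1)] by auto
    then have "f c = (\<Sum>t\<in>T. u t) *\<^sub>R y"
      using const by (simp add: linear_sum[OF f] linear_scale[OF f] scaleR_sum_left)
    then have "(\<Sum>t\<in>T. u t) = 0" using c \<open>y \<noteq> 0\<close> by simp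
    then have "c = (\<Sum>t\<in>T. u t *\<^sub>R (t - t0))"
      by (simp add: u scaleR_diff_right sum_subtractf scaleR_sum_left[symmetric])
    moreover have "(\<Sum>t\<in>T. u t *\<^sub>R (t - t0)) \<in> span D"
    proof (rule real_vector.span_sum)
      fix t assume "t \<in> T"
      show "u t *\<^sub>R (t - t0) \<in> span D"
      proof (cases "t = t0")
        case True
        then show ?thesis by (simp add: real_vector.span_zero)
      next
        case False
        with \<open>t \<in> T\<close> have "t - t0 \<in> D" by (simp add: D_def)
        then show ?thesis by (intro real_vector.span_scale real_vector.span_base)
      qed
    qed
    ultimately show "c \<in> span D" by simp
  qed
  then have "dim ?K \<le> card D" using T(1) by (intro real_vector.dim_le_card) (auto simp: D_def)
  also have "\<dots> \<le> card (T - {t0})" unfolding D_def using T(1) by (intro card_image_le) auto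
  also have "\<dots> = card T - 1" using t0 by simp
  finally have upper: "dim ?K \<le> card T - 1" .
  obtain S where S: "S \<subseteq> ?K" "independent S" "?K \<subseteq> span S" "card S = dim ?K"
    using real_vector.basis_exists by blast
  have finS: "finite S" using real_vector.independent_span_bound[OF T(1) S(2)] S(1) by auto
  have "T \<subseteq> span (insert t0 S)"
  proof
    fix t assume t: "t \<in> T"
    then have "t - t0 \<in> ?K"
      using t0 const by (simp add: linear_diff[OF f] real_vector.span_diff real_vector.span_base)
    then have "t - t0 \<in> span (insert t0 S)" using S(3) real_vector.span_mono[of S "insert t0 S"] by blast
    then have "(t - t0) + t0 \<in> span (insert t0 S)"
      by (intro real_vector.span_add) (auto intro: real_vector.span_base)
    then show "t \<in> span (insert t0 S)" by simp
  qed
  then have "card T \<le> card (insert t0 S)"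
    using real_vector.independent_span_bound[of "insert t0 S" T] T(3) finS by auto
  also have "\<dots> \<le> card S + 1" using finS by (simp add: card_insert_if)
  finally have "card T \<le> dim ?K + 1" using S(4) by simp
  moreover have "card T > 0" using T by (simp add: card_gt_0_iff)
  ultimately show ?thesis using upper by linarith
qed

section \<open>Rank and degeneracy of a graph\<close>

text \<open>
  Delete a vertex \<open>u\<close> of degree at most \<open>k\<close> and use induction. If \<open>u\<close> had a neighbour \<open>w\<close>, then
  \<open>e u - e w\<close> enlarges the independent set found for the rest, because \<open>e u\<close> is not in the span of the other
  \<open>e x\<close>; this pays for the at most \<open>k\<close> edges at \<open>u\<close>. If \<open>u\<close> was isolated, no edge is lost.
\<close>

lemma edges_le_degeneracy_times_rank:
  fixes e :: "'a \<Rightarrow> 'v::real_vector"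
  assumes "finite U" and "\<And>f. f \<in> E \<Longrightarrow> card f = 2"
    and "\<And>W. W \<subseteq> U \<Longrightarrow> W \<noteq> {} \<Longrightarrow> \<exists>u\<in>W. card (neighbours E u \<inter> W) \<le> k"
    and "independent (e ` U)" "inj_on e U"
  shows "\<exists>S \<subseteq> {e x - e w | x w. x \<in> U \<and> w \<in> U \<and> {w, x} \<in> E}.
    finite S \<and> independent S \<and> card (induced_edges E U) \<le> k * card S"
  using assms(1,3-)
proof (induction U rule: finite_psubset_induct)
  case (psubset U)
  note card2 = assms(2)
  have doubleton: "\<exists>x y. f = {x, y} \<and> x \<noteq> y" if "f \<in> E" for f
    using card2[OF that] by (meson card_2_iff)
  show ?case
  proof (cases "U = {}")
    case True
    then have "induced_edges E U = {}" using card2 by (force simp: induced_edges_def)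
    then show ?thesis by (intro exI[of _ "{}"]) (auto simp: real_vector.independent_empty)
  next
    case False
    then obtain u where u: "u \<in> U" "card (neighbours E u \<inter> U) \<le> k" using psubset.prems(1)[of U] by auto
    define W where "W = U - {u}"
    have W: "W \<subset> U" using u by (auto simp: W_def)
    have "\<exists>S \<subseteq> {e x - e w | x w. x \<in> W \<and> w \<in> W \<and> {w, x} \<in> E}.
        finite S \<and> independent S \<and> card (induced_edges E W) \<le> k * card S"
    proof (rule psubset.IH[OF W])
      show "\<And>X. X \<subseteq> W \<Longrightarrow> X \<noteq> {} \<Longrightarrow> \<exists>u\<in>X. card (neighbours E u \<inter> X) \<le> k"
        using psubset.prems(1) W by blast
      show "independent (e ` W)" by (rule real_vector.independent_mono[OF psubset.prems(2)]) (use W in blast)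
      show "inj_on e W" by (rule inj_on_subset[OF psubset.prems(3)]) (use W in blast)
    qed
    then obtain S where S: "S \<subseteq> {e x - e w | x w. x \<in> W \<and> w \<in> W \<and> {w, x} \<in> E}"
      "finite S" "independent S" "card (induced_edges E W) \<le> k * card S" by blast
    have finN: "finite (neighbours E u \<inter> U)" using psubset.hyps by auto
    have "induced_edges E U \<subseteq> induced_edges E W \<union> (\<lambda>w. {u, w}) ` (neighbours E u \<inter> U)"
    proof
      fix f assume f: "f \<in> induced_edges E U"
      then have fE: "f \<in> E" "f \<subseteq> U" by (auto simp: induced_edges_def)
      show "f \<in> induced_edges E W \<union> (\<lambda>w. {u, w}) ` (neighbours E u \<inter> U)"
      proof (cases "u \<in> f")
        case True
        with doubleton[OF fE(1)] obtain w where "f = {u, w}" by blast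
        then show ?thesis using fE by (auto simp: neighbours_def)
      next
        case False
        then show ?thesis using fE by (auto simp: induced_edges_def W_def)
      qed
    qed
    moreover have "finite (induced_edges E W)"
      by (rule finite_subset[of _ "Pow U"]) (use psubset.hyps in \<open>auto simp: induced_edges_def W_def\<close>)
    ultimately have "card (induced_edges E U)
        \<le> card (induced_edges E W \<union> (\<lambda>w. {u, w}) ` (neighbours E u \<inter> U))"
      using finN by (intro card_mono) auto
    also have "\<dots> \<le> card (induced_edges E W) + card ((\<lambda>w. {u, w}) ` (neighbours E u \<inter> U))"
      by (rule card_Un_le)
    also have "\<dots> \<le> k * card S + card (neighbours E u \<inter> U)"
      using S(4) card_image_le[OF finN] by (intro add_mono) auto
    finally have bound: "card (induced_edges E U) \<le> k * card S + card (neighbours E u \<inter> U)" .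
    have S': "S \<subseteq> {e x - e w | x w. x \<in> U \<and> w \<in> U \<and> {w, x} \<in> E}" using S(1) W by blast
    show ?thesis
    proof (cases "neighbours E u \<inter> U = {}")
      case True
      then show ?thesis using bound S S' by (intro exI[of _ S]) auto
    next
      case False
      then obtain w where w: "{u, w} \<in> E" "w \<in> U" by (auto simp: neighbours_def)
      have "u \<noteq> w" using card2[OF w(1)] by auto
      \<comment> \<open>\<open>e u\<close> occurs in no difference of \<open>S\<close>, so the new difference is independent of \<open>S\<close>\<close>
      have new: "e u - e w \<notin> span S"
      proof
        assume "e u - e w \<in> span S"
        moreover have "S \<subseteq> span (e ` W)"
        proof
          fix z assume "z \<in> S"
          then obtain x y where "z = e x - e y" "x \<in> W" "y \<in> W" using S(1) by blast
          then show "z \<in> span (e ` W)" by (simp add: real_vector.span_diff real_vector.span_base)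
        qed
        then have "span S \<subseteq> span (e ` W)" by (simp add: real_vector.span_minimal)
        ultimately have "e u - e w \<in> span (e ` W)" by blast
        moreover have "e w \<in> span (e ` W)"
          using w(2) \<open>u \<noteq> w\<close> by (simp add: W_def real_vector.span_base)
        ultimately have "(e u - e w) + e w \<in> span (e ` W)" by (rule real_vector.span_add)
        then have "e u \<in> span (e ` W)" by simp
        moreover have "e ` W \<subseteq> e ` U - {e u}"
          using psubset.prems(3) u(1) by (auto simp: W_def inj_on_def)
        ultimately have "e u \<in> span (e ` U - {e u})" using real_vector.span_mono by blast
        then show False using psubset.prems(2) u(1) by (auto simp: real_vector.dependent_def)
      qed
      then have "e u - e w \<notin> S" using real_vector.span_base by blast
      then have "card (insert (e u - e w) S) = card S + 1" using S(2) by simp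
      moreover have "independent (insert (e u - e w) S)"
        using real_vector.independent_insertI[OF new S(3)] .
      moreover have "e u - e w \<in> {e x - e w | x w. x \<in> U \<and> w \<in> U \<and> {w, x} \<in> E}"
        using u w by (auto simp: insert_commute)
      ultimately show ?thesis
        using bound u(2) S(2) S' by (intro exI[of _ "insert (e u - e w) S"]) auto
    qed
  qed
qed

section \<open>Homology of the star of a vertex\<close>

lemma scaleR_single: "r *\<^sub>R Poly_Mapping.single \<sigma> a = Poly_Mapping.single \<sigma> (r * a)"
  for \<sigma> :: "'a set"
  by (rule poly_mapping_eqI) (simp add: lookup_scaleR_chain lookup_single when_def)

text \<open>
  The simplices are indexed by an arbitrary family and carry arbitrary nonzero coefficients, so that basis vectors
  can be chosen with signs that make their boundaries uniform.
\<close>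

lemma rel_chains_eq_span:
  fixes g :: "'i \<Rightarrow> 'a set" and s :: "'i \<Rightarrow> real"
  assumes g: "g ` I = {\<sigma> \<in> X - Y. card \<sigma> = k + 1}" and s: "\<And>i. i \<in> I \<Longrightarrow> s i \<noteq> 0"
  shows "rel_chains X Y k = span ((\<lambda>i. Poly_Mapping.single (g i) (s i)) ` I)"
proof
  show "rel_chains X Y k \<subseteq> span ((\<lambda>i. Poly_Mapping.single (g i) (s i)) ` I)"
  proof
    fix c :: "'a chain" assume c: "c \<in> rel_chains X Y k"
    have "c = (\<Sum>\<sigma>\<in>Poly_Mapping.keys c. Poly_Mapping.single \<sigma> (Poly_Mapping.lookup c \<sigma>))"
    proof (rule poly_mapping_eqI)
      fix \<tau>
      show "Poly_Mapping.lookup c \<tau> = Poly_Mapping.lookup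
          (\<Sum>\<sigma>\<in>Poly_Mapping.keys c. Poly_Mapping.single \<sigma> (Poly_Mapping.lookup c \<sigma>)) \<tau>"
        by (simp add: lookup_sum lookup_single when_def in_keys_iff)
    qed
    also have "\<dots> \<in> span ((\<lambda>i. Poly_Mapping.single (g i) (s i)) ` I)"
    proof (rule real_vector.span_sum)
      fix \<sigma> assume "\<sigma> \<in> Poly_Mapping.keys c"
      then have "\<sigma> \<in> g ` I" using c g by (auto simp: rel_chains_def)
      then obtain i where i: "i \<in> I" "\<sigma> = g i" by blast
      have "Poly_Mapping.single \<sigma> (Poly_Mapping.lookup c \<sigma>)
          = (Poly_Mapping.lookup c \<sigma> / s i) *\<^sub>R Poly_Mapping.single (g i) (s i)"
        using s[OF i(1)] by (simp add: scaleR_single i(2))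
      then show "Poly_Mapping.single \<sigma> (Poly_Mapping.lookup c \<sigma>)
          \<in> span ((\<lambda>i. Poly_Mapping.single (g i) (s i)) ` I)"
        using i(1) by (simp add: real_vector.span_scale real_vector.span_base)
    qed
    finally show "c \<in> span ((\<lambda>i. Poly_Mapping.single (g i) (s i)) ` I)" .
  qed
  show "span ((\<lambda>i. Poly_Mapping.single (g i) (s i)) ` I) \<subseteq> rel_chains X Y k"
  proof (rule real_vector.span_minimal[OF _ subspace_rel_chains])
    show "(\<lambda>i. Poly_Mapping.single (g i) (s i)) ` I \<subseteq> rel_chains X Y k"
    proof
      fix c assume "c \<in> (\<lambda>i. Poly_Mapping.single (g i) (s i)) ` I"
      then obtain i where "i \<in> I" "c = Poly_Mapping.single (g i) (s i)" by blast
      moreover from this have "g i \<in> {\<sigma> \<in> X - Y. card \<sigma> = k + 1}" using g by blast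
      ultimately show "c \<in> rel_chains X Y k" by (simp add: rel_chains_def)
    qed
  qed
qed

lemma independent_singles:
  fixes g :: "'i \<Rightarrow> 'a set" and s :: "'i \<Rightarrow> real"
  assumes "finite I" and g: "inj_on g I" and s: "\<And>i. i \<in> I \<Longrightarrow> s i \<noteq> 0"
  shows "inj_on (\<lambda>i. Poly_Mapping.single (g i) (s i)) I"
    and "independent ((\<lambda>i. Poly_Mapping.single (g i) (s i)) ` I)"
proof -
  let ?f = "\<lambda>i. Poly_Mapping.single (g i) (s i)"
  show inj: "inj_on ?f I"
  proof (rule inj_onI)
    fix i j assume ij: "i \<in> I" "j \<in> I" "?f i = ?f j"
    have "Poly_Mapping.keys (?f i) = {g i}" "Poly_Mapping.keys (?f j) = {g j}"
      using s ij(1,2) by simp_all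
    then have "g i = g j" using ij(3) by (metis singleton_inject)
    then show "i = j" using g ij by (simp add: inj_on_def)
  qed
  show "independent (?f ` I)"
  proof (rule real_vector.independent_if_scalars_zero)
    show "finite (?f ` I)" using \<open>finite I\<close> by simp
    fix u x assume sum: "(\<Sum>x\<in>?f ` I. u x *\<^sub>R x) = 0" and "x \<in> ?f ` I"
    then obtain i where i: "i \<in> I" "x = ?f i" by blast
    have "0 = Poly_Mapping.lookup (\<Sum>j\<in>I. u (?f j) *\<^sub>R ?f j) (g i)"
      using sum by (simp add: sum.reindex[OF inj])
    also have "\<dots> = (\<Sum>j\<in>I. if j = i then u (?f j) * s j else 0)"
      unfolding lookup_sum
      by (rule sum.cong) (use g i(1) in \<open>auto simp: lookup_scaleR_chain lookup_single when_def inj_on_def\<close>)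
    also have "\<dots> = u (?f i) * s i" using \<open>finite I\<close> i(1) by simp
    finally show "u x = 0" using s[OF i(1)] i(2) by simp
  qed
qed

lemma rel_boundary_single:
  "k \<noteq> 0 \<Longrightarrow> rel_boundary Y k (Poly_Mapping.single \<sigma> r) = r *\<^sub>R simplex_boundary Y \<sigma>"
  by (cases "r = 0") (simp_all add: rel_boundary_def)

text \<open>
  Let \<open>e w\<close> be the edge \<open>{v, w}\<close> with the sign that makes its relative boundary \<open>+[v]\<close>; the
  other face \<open>[w]\<close> lies outside the star and vanishes. Of the faces of a triangle \<open>{v, w, x}\<close> only
  \<open>{v, w}\<close> and \<open>{v, x}\<close> survive, and since the boundary of a boundary is zero, they can only appear in
  a multiple of \<open>e x - e w\<close>. The 1-cycles thus have dimension \<open>deg v - 1\<close>, and the 1-boundaries are the span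
  of the differences belonging to the edges of the neighbourhood.
\<close>

lemma local_betti_1_eq:
  fixes V :: "'a::linorder set"
  assumes G: "locally_finite_graph V E" and v: "v \<in> V" and ne: "neighbours E v \<noteq> {}"
  obtains e :: "'a \<Rightarrow> 'a chain" where
    "inj_on e (neighbours E v)" "independent (e ` neighbours E v)"
    "local_betti (flag_complex V E) 1 {v}
       + dim {e x - e w | x w. x \<in> neighbours E v \<and> w \<in> neighbours E v \<and> {w, x} \<in> E} + 1 = deg E v"
proof -
  define N where "N = neighbours E v"
  define X where "X = flag_complex V E"
  define Y where "Y = X - star X {v}"
  \<comment> \<open>the sign of the face \<open>{v}\<close> in the boundary of \<open>{v, w}\<close>: \<open>w\<close> stands behind \<open>v\<close> exactly if \<open>v < w\<close>\<close>
  define sg where "sg w = (if v < w then - 1 else 1 :: real)" for w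
  define e where "e w = Poly_Mapping.single {v, w} (sg w)" for w
  \<comment> \<open>ordering the ends of an edge lists every triangle at \<open>v\<close> once\<close>
  define I where "I = {(w, x). w \<in> N \<and> x \<in> N \<and> {w, x} \<in> E \<and> w < x}"
  define D where "D = {e x - e w | x w. x \<in> N \<and> w \<in> N \<and> {w, x} \<in> E}"
  have finN: "finite N" using locally_finite_graph.finite_degree[OF G v] by (simp add: N_def)
  have E: "f \<subseteq> V" "card f = 2" if "f \<in> E" for f using locally_finite_graph.edges[OF G that] by auto
  have loop: "{x} \<notin> E" for x using E(2)[of "{x}"] by auto
  have N: "{v, w} \<in> E" "{w, v} \<in> E" "w \<in> V" "w \<noteq> v" if "w \<in> N" for w
    using that E(1)[of "{v, w}"] loop[of v] by (auto simp: N_def neighbours_def insert_commute)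
  have XY: "X - Y = {\<sigma> \<in> X. v \<in> \<sigma>}" by (auto simp: Y_def star_def)
  have Y: "\<sigma> \<in> Y \<longleftrightarrow> \<sigma> \<in> X \<and> v \<notin> \<sigma>" for \<sigma> by (auto simp: Y_def star_def)
  have sg: "sg w \<noteq> 0" "sg w * sg w = 1" for w by (auto simp: sg_def)
  have edges: "(\<lambda>w. {v, w}) ` N = {\<sigma> \<in> X - Y. card \<sigma> = 1 + 1}"
  proof
    show "(\<lambda>w. {v, w}) ` N \<subseteq> {\<sigma> \<in> X - Y. card \<sigma> = 1 + 1}"
    proof
      fix \<sigma> assume "\<sigma> \<in> (\<lambda>w. {v, w}) ` N"
      then obtain w where "w \<in> N" "\<sigma> = {v, w}" by blast
      then show "\<sigma> \<in> {\<sigma> \<in> X - Y. card \<sigma> = 1 + 1}"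
        using N[of w] v unfolding XY by (auto simp: X_def flag_complex_def)
    qed
    show "{\<sigma> \<in> X - Y. card \<sigma> = 1 + 1} \<subseteq> (\<lambda>w. {v, w}) ` N"
    proof
      fix \<sigma> assume "\<sigma> \<in> {\<sigma> \<in> X - Y. card \<sigma> = 1 + 1}"
      then have \<sigma>: "\<sigma> \<in> X" "v \<in> \<sigma>" "card \<sigma> = 2" unfolding XY by auto
      then obtain w where w: "\<sigma> = {v, w}" "w \<noteq> v" by (auto simp: card_2_iff)
      then have "{v, w} \<in> E" using \<sigma>(1) by (auto simp: X_def flag_complex_def)
      then show "\<sigma> \<in> (\<lambda>w. {v, w}) ` N" using w by (auto simp: N_def neighbours_def)
    qed
  qed
  have triangles: "(\<lambda>(w, x). {v, w, x}) ` I = {\<sigma> \<in> X - Y. card \<sigma> = 2 + 1}"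
  proof
    show "(\<lambda>(w, x). {v, w, x}) ` I \<subseteq> {\<sigma> \<in> X - Y. card \<sigma> = 2 + 1}"
    proof
      fix \<sigma> assume "\<sigma> \<in> (\<lambda>(w, x). {v, w, x}) ` I"
      then obtain w x where wx: "w \<in> N" "x \<in> N" "{w, x} \<in> E" "w < x" "\<sigma> = {v, w, x}"
        by (auto simp: I_def)
      then have "\<sigma> \<in> X"
        using N[of w] N[of x] v by (auto simp: X_def flag_complex_def insert_commute)
      then show "\<sigma> \<in> {\<sigma> \<in> X - Y. card \<sigma> = 2 + 1}"
        using wx N(4)[of w] N(4)[of x] unfolding XY by auto
    qed
    show "{\<sigma> \<in> X - Y. card \<sigma> = 2 + 1} \<subseteq> (\<lambda>(w, x). {v, w, x}) ` I"
    proof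
      fix \<sigma> assume "\<sigma> \<in> {\<sigma> \<in> X - Y. card \<sigma> = 2 + 1}"
      then have \<sigma>: "\<sigma> \<in> X" "v \<in> \<sigma>" "card \<sigma> = 3" unfolding XY by auto
      then have "card (\<sigma> - {v}) = 2" by simp
      then obtain a b where ab: "\<sigma> - {v} = {a, b}" "a \<noteq> b" by (auto simp: card_2_iff)
      obtain w x where wx: "\<sigma> - {v} = {w, x}" "w < x"
      proof (cases "a < b")
        case True
        with ab that show ?thesis by blast
      next
        case False
        then have "b < a" using ab(2) by simp
        with ab that[of b a] show ?thesis by (simp add: insert_commute)
      qed
      have s: "\<sigma> = {v, w, x}" "w \<in> \<sigma>" "x \<in> \<sigma>" "w \<noteq> v" "x \<noteq> v"
        using wx(1) \<sigma>(2) by blast+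
      have adj: "{y, z} \<in> E" if "y \<in> \<sigma>" "z \<in> \<sigma>" "y \<noteq> z" for y z
        using \<sigma>(1) that by (simp add: X_def flag_complex_def)
      have "(w, x) \<in> I"
        using adj[of v w] adj[of v x] adj[of w x] s wx(2) \<sigma>(2) by (auto simp: I_def N_def neighbours_def)
      then show "\<sigma> \<in> (\<lambda>(w, x). {v, w, x}) ` I" using s(1) by force
    qed
  qed
  have faceY: "{w} \<in> Y" if "w \<in> N" for w
    using N[OF that] by (auto simp: Y X_def flag_complex_def)
  have bd1: "rel_boundary Y 1 (e w) = Poly_Mapping.single {v} 1" if w: "w \<in> N" for w
  proof -
    have faces: "{v, w} - {v} = {w}" "{v, w} - {w} = {v}" using N(4)[OF w] by auto
    have "{v} \<notin> Y" by (simp add: Y)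
    then have "u \<in> {v, w} \<and> {v, w} - {u} \<notin> Y \<longleftrightarrow> u = w" for u
      using faces faceY[OF w] by (metis insertCI insertE singletonD)
    then have "{u. u \<in> {v, w} \<and> {v, w} - {u} \<notin> Y} = {w}" by simp
    moreover note faces(2)
    moreover have "{y \<in> {v, w}. y < w} = (if v < w then {v} else {})" by auto
    ultimately have "simplex_boundary Y {v, w} = Poly_Mapping.single {v} (sg w)"
      unfolding simplex_boundary_def by (simp add: sg_def)
    then show ?thesis by (simp add: e_def rel_boundary_single scaleR_single sg)
  qed
  \<comment> \<open>the coefficient makes up for the orientation of the triangle by the vertex order\<close>
  have bd2: "rel_boundary Y 2 (Poly_Mapping.single {v, w, x} (sg w * sg x)) = e x - e w"
    if wx: "(w, x) \<in> I" for w x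
  proof -
    have w: "w \<in> N" "x \<in> N" "{w, x} \<in> E" "w < x" using wx by (auto simp: I_def)
    note Nw = N[OF w(1)] and Nx = N[OF w(2)]
    have faces: "{v, w, x} - {v} = {w, x}" "{v, w, x} - {w} = {v, x}" "{v, w, x} - {x} = {v, w}"
      using Nw(4) Nx(4) w(4) by auto
    have "{w, x} \<in> Y" using w Nw Nx by (auto simp: Y X_def flag_complex_def insert_commute)
    moreover have "{v, x} \<notin> Y" "{v, w} \<notin> Y" by (simp_all add: Y)
    ultimately have "u \<in> {v, w, x} \<and> {v, w, x} - {u} \<notin> Y \<longleftrightarrow> u = w \<or> u = x" for u
      using faces by (metis insertCI insertE singletonD)
    then have "{u. u \<in> {v, w, x} \<and> {v, w, x} - {u} \<notin> Y} = {w, x}" by (simp add: set_eq_iff)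
    moreover have "(- 1) ^ card {y \<in> {v, w, x}. y < w} = sg w"
    proof -
      have "{y \<in> {v, w, x}. y < w} = (if v < w then {v} else {})" using w(4) by auto
      then show ?thesis by (simp add: sg_def)
    qed
    moreover have "(- 1) ^ card {y \<in> {v, w, x}. y < x} = - sg x"
    proof -
      have "{y \<in> {v, w, x}. y < x} = (if v < x then {v, w} else {w})" using w(4) by auto
      then show ?thesis using Nw(4) by (simp add: sg_def)
    qed
    ultimately have bd: "simplex_boundary Y {v, w, x}
        = Poly_Mapping.single {v, x} (sg w) - Poly_Mapping.single {v, w} (sg x)"
      unfolding simplex_boundary_def using w(4) faces by (simp add: single_uminus)
    have signs: "(sg w * sg x) * sg w = sg x" "(sg w * sg x) * sg x = sg w"
      by (auto simp: sg_def)
    have "rel_boundary Y 2 (Poly_Mapping.single {v, w, x} (sg w * sg x))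
        = (sg w * sg x) *\<^sub>R simplex_boundary Y {v, w, x}"
      by (rule rel_boundary_single) simp
    then show ?thesis unfolding bd scaleR_diff_right scaleR_single signs e_def .
  qed
  have injN: "inj_on (\<lambda>w. {v, w}) N" by (auto simp: inj_on_def doubleton_eq_iff)
  have ind: "inj_on e N" "independent (e ` N)"
    unfolding e_def by (rule independent_singles[OF finN injN sg(1)])+
  have C1: "rel_chains X Y 1 = span (e ` N)"
    unfolding e_def by (rule rel_chains_eq_span[OF edges sg(1)])
  have Z: "rel_cycles X Y 1 = {c \<in> span (e ` N). rel_boundary Y 1 c = 0}"
    unfolding rel_cycles_def C1 ..
  have "rel_boundaries X Y 1 = rel_boundary Y 2 ` rel_chains X Y 2"
    unfolding rel_boundaries_def one_add_one ..
  also have "rel_chains X Y 2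
      = span ((\<lambda>i. Poly_Mapping.single ((\<lambda>(w, x). {v, w, x}) i) ((\<lambda>(w, x). sg w * sg x) i)) ` I)"
    by (rule rel_chains_eq_span[OF triangles]) (auto simp: sg)
  also have "rel_boundary Y 2 ` \<dots> = span (rel_boundary Y 2 `
      (\<lambda>i. Poly_Mapping.single ((\<lambda>(w, x). {v, w, x}) i) ((\<lambda>(w, x). sg w * sg x) i)) ` I)"
    by (rule linear_span_image[OF linear_rel_boundary, symmetric])
  also have "rel_boundary Y 2 `
      (\<lambda>i. Poly_Mapping.single ((\<lambda>(w, x). {v, w, x}) i) ((\<lambda>(w, x). sg w * sg x) i)) ` I
      = (\<lambda>(w, x). e x - e w) ` I"
    unfolding image_image by (rule image_cong) (auto simp: bd2)
  also have "span ((\<lambda>(w, x). e x - e w) ` I) = span D"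
  proof (rule equalityI; rule real_vector.span_minimal[OF _ real_vector.subspace_span])
    show "(\<lambda>(w, x). e x - e w) ` I \<subseteq> span D"
    proof
      fix c assume "c \<in> (\<lambda>(w, x). e x - e w) ` I"
      then have "c \<in> D" by (auto simp: I_def D_def)
      then show "c \<in> span D" by (rule real_vector.span_base)
    qed
    show "D \<subseteq> span ((\<lambda>(w, x). e x - e w) ` I)"
    proof
      fix c assume "c \<in> D"
      then obtain x w where c: "c = e x - e w" "x \<in> N" "w \<in> N" "{w, x} \<in> E" by (auto simp: D_def)
      have "w \<noteq> x" using c(4) loop by auto
      then consider "w < x" | "x < w" using less_linear[of w x] by blast
      then consider "(w, x) \<in> I" | "(x, w) \<in> I"
        using c by cases (auto simp: I_def insert_commute)
      then show "c \<in> span ((\<lambda>(w, x). e x - e w) ` I)"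
      proof cases
        case 1
        then show ?thesis unfolding c(1) by (intro real_vector.span_base) force
      next
        case 2
        then have "e w - e x \<in> span ((\<lambda>(w, x). e x - e w) ` I)"
          by (intro real_vector.span_base) force
        from real_vector.span_neg[OF this] show ?thesis by (simp add: c(1))
      qed
    qed
  qed
  finally have B: "rel_boundaries X Y 1 = span D" .
  have BZ: "rel_boundaries X Y 1 \<subseteq> rel_cycles X Y 1"
    unfolding B
  proof (rule real_vector.span_minimal[OF _ subspace_rel_cycles])
    show "D \<subseteq> rel_cycles X Y 1"
    proof
      fix c assume "c \<in> D"
      then obtain x w where "c = e x - e w" "x \<in> N" "w \<in> N" by (auto simp: D_def)
      then show "c \<in> rel_cycles X Y 1"
        unfolding Z using bd1[of x] bd1[of w]
        by (simp add: linear_diff[OF linear_rel_boundary] real_vector.span_diff real_vector.span_base)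
    qed
  qed
  have "local_betti X 1 {v} + dim (rel_boundaries X Y 1) = dim (rel_cycles X Y 1)"
    unfolding local_betti_def rel_homology_def Y_def[symmetric]
    by (rule dim_quotient_vs[OF subspace_rel_cycles subspace_rel_boundaries BZ, of "e ` N"])
      (use finN Z in auto)
  moreover have "dim (rel_cycles X Y 1) + 1 = card (e ` N)"
    unfolding Z
  proof (rule dim_kernel_of_constant_on_basis[OF linear_rel_boundary _ _ ind(2)])
    show "\<And>t. t \<in> e ` N \<Longrightarrow> rel_boundary Y 1 t = Poly_Mapping.single {v} 1"
      by (auto simp: bd1 simp del: One_nat_def)
    show "Poly_Mapping.single {v} (1::real) \<noteq> 0" by (metis keys_single keys_zero insert_not_empty zero_neq_one)
  qed (use finN ne N_def in auto)
  ultimately have "local_betti X 1 {v} + dim D + 1 = card N"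
    unfolding B real_vector.dim_span using card_image[OF ind(1)] by linarith
  then show thesis
    using that[of e] ind unfolding N_def D_def X_def deg_def by simp
qed

section \<open>The bounds\<close>

text \<open>
  One of the two differences belonging to an edge generates the other, so one vector per edge is enough.
\<close>

lemma edge_differences_spanned_by_edge_many:
  fixes e :: "'a \<Rightarrow> 'v::real_vector"
  assumes fin: "finite N" and card2: "\<And>f. f \<in> E \<Longrightarrow> card f = 2"
  shows "\<exists>F. finite F \<and> card F \<le> card (induced_edges E N) \<and>
    {e x - e w | x w. x \<in> N \<and> w \<in> N \<and> {w, x} \<in> E} \<subseteq> span F"
proof -
  have finE: "finite (induced_edges E N)"
    by (rule finite_subset[of _ "Pow N"]) (use fin in \<open>auto simp: induced_edges_def\<close>)
  have "\<exists>d. f = {fst d, snd d}" if "f \<in> induced_edges E N" for f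
  proof -
    have "card f = 2" using that card2 by (simp add: induced_edges_def)
    then obtain x y where "f = {x, y}" by (auto simp: card_2_iff)
    then show ?thesis by (intro exI[of _ "(x, y)"]) simp
  qed
  then obtain d where d: "\<And>f. f \<in> induced_edges E N \<Longrightarrow> f = {fst (d f), snd (d f)}" by metis
  define F where "F = (\<lambda>f. e (fst (d f)) - e (snd (d f))) ` induced_edges E N"
  have "{e x - e w | x w. x \<in> N \<and> w \<in> N \<and> {w, x} \<in> E} \<subseteq> span F"
  proof
    fix c assume "c \<in> {e x - e w | x w. x \<in> N \<and> w \<in> N \<and> {w, x} \<in> E}"
    then obtain x w where c: "c = e x - e w" "x \<in> N" "w \<in> N" "{w, x} \<in> E" by blast
    then have f: "{w, x} \<in> induced_edges E N" by (simp add: induced_edges_def)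
    have base: "e (fst (d {w, x})) - e (snd (d {w, x})) \<in> span F"
      unfolding F_def using f by (intro real_vector.span_base) blast
    from d[OF f] consider "fst (d {w, x}) = w" "snd (d {w, x}) = x"
      | "fst (d {w, x}) = x" "snd (d {w, x}) = w" by (auto simp: doubleton_eq_iff)
    then show "c \<in> span F"
    proof cases
      case 1
      then show ?thesis using real_vector.span_neg[OF base] by (simp add: c(1))
    next
      case 2
      then show ?thesis using base by (simp add: c(1))
    qed
  qed
  then show ?thesis
    using finE card_image_le[OF finE] by (intro exI[of _ F]) (auto simp: F_def)
qed

theorem theorem32:
  fixes V :: "'a::linorder set" and E :: "'a set set" and v :: 'a
  assumes "locally_finite_graph V E"
    and "planar_graph V E"
    and "v \<in> V"
    and "deg E v \<ge> 2"
  shows "real (deg E v) - 1 - real (deg E v) * (real (deg E v) - 1) * clustering_coeff E v / 2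
           \<le> real (local_betti (flag_complex V E) 1 {v})
       \<and> real (local_betti (flag_complex V E) 1 {v})
           \<le> real (deg E v) - 1 - real (deg E v) * (real (deg E v) - 1) * clustering_coeff E v / 6"
proof -
  let ?N = "neighbours E v"
  define m where "m = card (induced_edges E ?N)"
  have fin: "finite ?N" using locally_finite_graph.finite_degree assms(1,3) by metis
  have card2: "card f = 2" if "f \<in> E" for f using locally_finite_graph.edges[OF assms(1) that] by simp
  have ne: "?N \<noteq> {}" using assms(4) by (auto simp: deg_def)
  obtain e :: "'a \<Rightarrow> 'a chain" where e: "inj_on e ?N" "independent (e ` ?N)"
    "local_betti (flag_complex V E) 1 {v}
       + dim {e x - e w | x w. x \<in> ?N \<and> w \<in> ?N \<and> {w, x} \<in> E} + 1 = deg E v"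
    by (rule local_betti_1_eq[OF assms(1,3) ne])
  let ?D = "{e x - e w | x w. x \<in> ?N \<and> w \<in> ?N \<and> {w, x} \<in> E}"
  obtain F where F: "finite F" "card F \<le> m" "?D \<subseteq> span F"
    unfolding m_def using edge_differences_spanned_by_edge_many[OF fin card2] by blast
  have upper: "dim ?D \<le> m" using real_vector.dim_le_card[OF F(3,1)] F(2) by linarith
  obtain p \<gamma> where D: "planar_drawing V E p \<gamma>" using assms(2) by (auto simp: planar_graph_def)
  have "\<exists>S \<subseteq> ?D. finite S \<and> independent S \<and> m \<le> 3 * card S"
    unfolding m_def
  proof (rule edges_le_degeneracy_times_rank[OF fin card2 _ e(2,1)])
    fix W assume W: "W \<subseteq> ?N" "W \<noteq> {}"
    show "\<exists>u\<in>W. card (neighbours E u \<inter> W) \<le> 3"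
      by (rule neighbourhood_has_vertex_of_degree_le_3[OF assms(1) D finite_subset[OF W(1) fin] W(2,1)])
  qed
  then obtain S where S: "S \<subseteq> ?D" "independent S" "m \<le> 3 * card S" by blast
  have lower: "m \<le> 3 * dim ?D"
    using card_independent_le_dim[OF F(1,3) S(1,2)] S(3) by linarith
  have choose: "2 * real (deg E v choose 2) = real (deg E v) * (real (deg E v) - 1)"
  proof -
    have "even (deg E v * (deg E v - 1))" by (cases "deg E v") auto
    then have "2 * (deg E v choose 2) = deg E v * (deg E v - 1)" by (simp add: choose_two)
    then have "2 * real (deg E v choose 2) = real (deg E v * (deg E v - 1))"
      by (metis of_nat_mult of_nat_numeral)
    then show ?thesis using assms(4) by (simp add: of_nat_diff)
  qed
  have edges: "real (deg E v) * (real (deg E v) - 1) * clustering_coeff E v = 2 * real m"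
  proof -
    have "real (deg E v choose 2) \<noteq> 0" using assms(4) by simp
    then show ?thesis by (simp add: clustering_coeff_def m_def choose[symmetric])
  qed
  have "real (local_betti (flag_complex V E) 1 {v}) + real (dim ?D) + 1 = real (deg E v)"
    by (simp only: e(3)[symmetric] of_nat_add of_nat_1)
  moreover have "real (dim ?D) \<le> real m" "real m \<le> 3 * real (dim ?D)"
    using upper lower by linarith+
  ultimately show ?thesis unfolding edges by (intro conjI; linarith)
qed

end
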